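(* For every list of integers $[i_1,\dots,i_s]$ with $i_1\ge\dots\ge i_s>0$ and $\sum_m i_m=d$, the open subset $\mathbb Q_{[i_1,\dots,i_s]}$ of $\mathrm{Quot}^d_{\mathcal F^r/\mathbb P^1/k}$ is isomorphic to the affine space $\mathbb A^{dr}=\mathrm{Spec}(k[w_{h,m}]_{h=1,\dots,d,\ m=1,\dots,r})$. An explicit isomorphism $\phi_{[i_1,\dots,i_s]}$ can be obtained by associating to $w_{1,m},\dots,w_{d,m}$ (for each $m=1,\dots,r$) the entries of the first column in the $m$-th block of $\mathbf C(M)$ that does not belong to the chosen identity submatrix $\mathrm{Id}_{[i_1,\dots,i_s]}$.
   Context: $k$ is an algebraically closed field of any characteristic; $r\ge 2$ and $d\ge 1$ are fixed integers. For a $k$-algebra $A$ put $S_A=A[x,y]$, $\mathbb P^1_A=\mathrm{Proj}(S_A)$, $F_A^r=\bigoplus^rS_A$ with standard basis $e_1,\dots,e_r$, $\mathcal F^r=\bigoplus^r\mathcal O_{\mathbb P^1}$. $\mathrm{Quot}^d_{\mathcal F^r/\mathbb P^1/k}$ is the Quot scheme of flat quotients of $\mathcal F^r$ with constant Hilbert polynomial $d$; an $A$-point is a saturated graded quotient $F_A^r/V$ whose components of degree $\ge d$ are locally free of rank $d$ over $A$, and it is identified with its degree $d$ component $M=(F_A^r/V)_d$, a rank $d$ locally free quotient of $\bigoplus^rS_{A,d}$. For integers $i_1\ge\dots\ge i_s>0$ with $s\le r$ and $\sum_m i_m=d$, $\mathbb Q_{[i_1,\dots,i_s]}$ is the open subscheme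 of $\mathrm{Quot}^d_{\mathcal F^r/\mathbb P^1/k}$ whose $A$-points are the $M$ for which the images of the elements $x^{d-j}y^je_m$ ($1\le m\le s$, $0\le j\le i_m-1$) form an $A$-basis of $M$. For such $M$, using this basis (ordered by $m$, then by $j$), $\mathbf C(M)$ is the $d\times(d+1)r$ matrix over $A$ whose columns are the coordinates of the images in $M$ of the ordered list $x^de_1,x^{d-1}ye_1,\dots,y^de_1,\dots,x^de_r,x^{d-1}ye_r,\dots,y^de_r$. Its $m$-th block consists of the $d+1$ columns corresponding to $e_m$. $\mathrm{Id}_{[i_1,\dots,i_s]}$ is the submatrix of $\mathbf C(M)$ formed by the first $i_m$ columns of the $m$-th block for $m=1,\dots,s$; it is the $d\times d$ identity matrix. Thus the column referred to in the claim is the $(i_m+1)$-st column of the $m$-th block if $m\le s$, and the first column of the $m$-th block if $m>s$. *)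

theory Defs
  imports
    "HOL-Computational_Algebra.Polynomial"
    "HOL-Library.Poly_Mapping"
    "HOL-Library.Product_Plus"
    "HOL-Library.FuncSet"
    "Jordan_Normal_Form.Matrix"
begin

text \<open>
  All schemes are treated through their functors of points on commutative \<open>k\<close>-algebras.  A
  \<open>k\<close>-algebra is a commutative unital ring \<open>A\<close> with a unital ring homomorphism \<open>k \<rightarrow> A\<close>.  Rings are
  types of sort \<open>{comm_ring, comm_monoid_mult}\<close>, which differs from the class \<open>comm_ring_1\<close>
  only in that it admits the zero ring.

  All indices start at 0: the basis vector \<open>e\<^sub>m\<close>, the variable \<open>w\<^sub>h\<^sub>,\<^sub>m\<close> and the number \<open>i\<^sub>m\<close> of the
  paper have index \<open>m - 1\<close> (and \<open>h - 1\<close>) here.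
\<close>

definition unital_ring_hom ::
  "('a::{comm_ring,comm_monoid_mult} \<Rightarrow> 'b::{comm_ring,comm_monoid_mult}) \<Rightarrow> bool" where
  "unital_ring_hom f \<longleftrightarrow>
     f 1 = 1 \<and> (\<forall>a b. f (a + b) = f a + f b) \<and> (\<forall>a b. f (a * b) = f a * f b)"


section \<open>Graded submodules of the free module over \<open>A[x,y]\<close>\<close>

text \<open>The exponent \<open>(a, b)\<close> stands for the monomial \<open>x\<^sup>a y\<^sup>b\<close>.\<close>

type_synonym 'a bipoly = "(nat \<times> nat) \<Rightarrow>\<^sub>0 'a"
type_synonym 'a bivec = "nat \<Rightarrow> 'a bipoly"

abbreviation xy :: "nat \<Rightarrow> nat \<Rightarrow> 'a::{comm_ring,comm_monoid_mult} bipoly" where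
  "xy a b \<equiv> Poly_Mapping.single (a, b) 1"

abbreviation const :: "'a::{comm_ring,comm_monoid_mult} \<Rightarrow> 'a bipoly" where
  "const c \<equiv> Poly_Mapping.single (0, 0) c"

text \<open>The graded module \<open>F\<^sub>A\<^sup>r\<close> and its component of degree \<open>n\<close>.\<close>

definition free_module :: "nat \<Rightarrow> 'a::{comm_ring,comm_monoid_mult} bivec set" where
  "free_module r = {f. \<forall>m\<ge>r. f m = 0}"

definition free_module_deg :: "nat \<Rightarrow> nat \<Rightarrow> 'a::{comm_ring,comm_monoid_mult} bivec set" where
  "free_module_deg r n =
     {f \<in> free_module r. \<forall>m. \<forall>(a, b) \<in> Poly_Mapping.keys (f m). a + b = n}"

definition smult_vec :: "'a::{comm_ring,comm_monoid_mult} bipoly \<Rightarrow> 'a bivec \<Rightarrow> 'a bivec" where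
  "smult_vec p f = (\<lambda>m. p * f m)"

definition hom_component :: "nat \<Rightarrow> 'a::{comm_ring,comm_monoid_mult} bivec \<Rightarrow> 'a bivec" where
  "hom_component n f =
     (\<lambda>m. \<Sum>j\<le>n. Poly_Mapping.single (n - j, j) (Poly_Mapping.lookup (f m) (n - j, j)))"

definition is_submodule :: "nat \<Rightarrow> 'a::{comm_ring,comm_monoid_mult} bivec set \<Rightarrow> bool" where
  "is_submodule r V \<longleftrightarrow>
     V \<subseteq> free_module r \<and> (\<lambda>m. 0) \<in> V \<and>
     (\<forall>f\<in>V. \<forall>g\<in>V. (\<lambda>m. f m + g m) \<in> V) \<and>
     (\<forall>p. \<forall>f\<in>V. smult_vec p f \<in> V)"

definition is_graded_submodule :: "nat \<Rightarrow> 'a::{comm_ring,comm_monoid_mult} bivec set \<Rightarrow> bool" where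
  "is_graded_submodule r V \<longleftrightarrow>
     is_submodule r V \<and> (\<forall>f\<in>V. \<forall>n. hom_component n f \<in> V)"

text \<open>The elements \<open>f\<close> with \<open>(x,y)\<^sup>N f \<subseteq> V\<close> for some \<open>N\<close>.\<close>

definition saturation ::
  "nat \<Rightarrow> 'a::{comm_ring,comm_monoid_mult} bivec set \<Rightarrow> 'a bivec set" where
  "saturation r V =
     {f \<in> free_module r. \<exists>N. \<forall>a b. a + b = N \<longrightarrow> smult_vec (xy a b) f \<in> V}"

definition is_saturated :: "nat \<Rightarrow> 'a::{comm_ring,comm_monoid_mult} bivec set \<Rightarrow> bool" where
  "is_saturated r V \<longleftrightarrow> saturation r V \<subseteq> V"


section \<open>Bases of quotients, local freeness\<close>

text \<open>
  Below, \<open>N\<close> is an \<open>A\<close>-module of vectors of polynomials (always some \<open>(F\<^sub>A\<^sup>r)\<^sub>n\<close>) and the \<open>A\<close>-module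
  under consideration is the image of \<open>N\<close> in \<open>F\<^sub>A\<^sup>r/V\<close>, i.e. \<open>N/(N \<inter> V)\<close>.  Its elements are given
  by representatives in \<open>N\<close>, which are equal in the quotient iff their difference is in \<open>V\<close>.
\<close>

definition lin_comb :: "'a::{comm_ring,comm_monoid_mult} vec \<Rightarrow> 'a bivec list \<Rightarrow> 'a bivec" where
  "lin_comb c bs = (\<lambda>m. \<Sum>h<length bs. const (c $ h) * (bs ! h) m)"

definition is_quotient_basis ::
  "'a::{comm_ring,comm_monoid_mult} bivec set \<Rightarrow> 'a bivec set \<Rightarrow> 'a bivec list \<Rightarrow> bool" where
  "is_quotient_basis N V bs \<longleftrightarrow>
     set bs \<subseteq> N \<and>
     (\<forall>f\<in>N. \<exists>c\<in>carrier_vec (length bs). (\<lambda>m. f m - lin_comb c bs m) \<in> V) \<and>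
     (\<forall>c\<in>carrier_vec (length bs). lin_comb c bs \<in> V \<longrightarrow> (\<forall>h<length bs. c $ h = 0))"

definition quotient_coords ::
  "'a::{comm_ring,comm_monoid_mult} bivec set \<Rightarrow> 'a bivec list \<Rightarrow> 'a bivec \<Rightarrow> 'a vec" where
  "quotient_coords V bs f =
     (THE c. c \<in> carrier_vec (length bs) \<and> (\<lambda>m. f m - lin_comb c bs m) \<in> V)"

text \<open>
  The images of \<open>bs\<close> form a basis of the localized module \<open>M\<^sub>s\<close> over \<open>A\<^sub>s\<close>, where \<open>M = N/(N \<inter> V)\<close>.
  In a localization, \<open>g = 0\<close> means that \<open>g\<close> is killed by some power of \<open>s\<close>, and denominators are
  powers of \<open>s\<close>; this unfolds generation and linear independence as follows.
\<close>

definition is_localized_quotient_basis ::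
  "'a::{comm_ring,comm_monoid_mult} \<Rightarrow> 'a bivec set \<Rightarrow> 'a bivec set \<Rightarrow> 'a bivec list \<Rightarrow> bool" where
  "is_localized_quotient_basis s N V bs \<longleftrightarrow>
     set bs \<subseteq> N \<and>
     (\<forall>f\<in>N. \<exists>p. \<exists>c\<in>carrier_vec (length bs).
        (\<lambda>m. const (s ^ p) * f m - lin_comb c bs m) \<in> V) \<and>
     (\<forall>c\<in>carrier_vec (length bs). (\<exists>p. smult_vec (const (s ^ p)) (lin_comb c bs) \<in> V) \<longrightarrow>
        (\<forall>h<length bs. \<exists>q. s ^ q * c $ h = 0))"

text \<open>
  Local freeness of rank \<open>n\<close> on the cover of \<open>Spec A\<close> by the basic open sets \<open>D(s)\<close>, \<open>s \<in> E\<close>.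
  A basis of \<open>M\<^sub>s\<close> can be rescaled by powers of the unit \<open>s\<close>, so it may be taken in the image of
  \<open>M\<close>.
\<close>

definition locally_free_quotient ::
  "nat \<Rightarrow> 'a::{comm_ring,comm_monoid_mult} bivec set \<Rightarrow> 'a bivec set \<Rightarrow> bool" where
  "locally_free_quotient n N V \<longleftrightarrow>
     (\<exists>E. finite E \<and> (\<exists>u. (\<Sum>s\<in>E. u s * s) = 1) \<and>
        (\<forall>s\<in>E. \<exists>bs. length bs = n \<and> is_localized_quotient_basis s N V bs))"


section \<open>The Quot functor and its open subfunctors\<close>

definition Quot_points :: "nat \<Rightarrow> nat \<Rightarrow> 'a::{comm_ring,comm_monoid_mult} bivec set set" where
  "Quot_points r d =
     {V. is_graded_submodule r V \<and> is_saturated r V \<and>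
         (\<forall>n\<ge>d. locally_free_quotient d (free_module_deg r n) V)}"

text \<open>
  Functoriality of \<open>Quot\<close> along \<open>h : A \<rightarrow> B\<close>: the pulled back quotient sheaf corresponds to the
  saturation of the submodule of \<open>F\<^sub>B\<^sup>r\<close> generated by the image of \<open>V\<close>.
\<close>

definition base_change ::
  "nat \<Rightarrow> ('a::{comm_ring,comm_monoid_mult} \<Rightarrow> 'b::{comm_ring,comm_monoid_mult}) \<Rightarrow>
     'a bivec set \<Rightarrow> 'b bivec set" where
  "base_change r h V =
     saturation r (\<Inter>{W. is_submodule r W \<and> (\<forall>f\<in>V. (\<lambda>m. Poly_Mapping.map h (f m)) \<in> W)})"

text \<open>The element \<open>x\<^sup>d\<^sup>-\<^sup>j y\<^sup>j e\<^sub>m\<close>.\<close>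

definition monomial_vec :: "nat \<Rightarrow> nat \<Rightarrow> nat \<Rightarrow> 'a::{comm_ring,comm_monoid_mult} bivec" where
  "monomial_vec d m j = (\<lambda>m'. if m' = m then xy (d - j) j else 0)"

definition chosen_monomials :: "nat \<Rightarrow> nat list \<Rightarrow> 'a::{comm_ring,comm_monoid_mult} bivec list" where
  "chosen_monomials d il =
     concat (map (\<lambda>m. map (monomial_vec d m) [0..<il ! m]) [0..<length il])"

definition all_monomials :: "nat \<Rightarrow> nat \<Rightarrow> 'a::{comm_ring,comm_monoid_mult} bivec list" where
  "all_monomials r d = concat (map (\<lambda>m. map (monomial_vec d m) [0..<d + 1]) [0..<r])"

text \<open>The \<open>A\<close>-points of \<open>\<bbbQ>\<close> for the list \<open>il = [i\<^sub>1, \<dots>, i\<^sub>s]\<close>; here \<open>M = (F\<^sub>A\<^sup>r/V)\<^sub>d\<close>.\<close>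

definition Q_points ::
  "nat \<Rightarrow> nat \<Rightarrow> nat list \<Rightarrow> 'a::{comm_ring,comm_monoid_mult} bivec set set" where
  "Q_points r d il =
     {V \<in> Quot_points r d. is_quotient_basis (free_module_deg r d) V (chosen_monomials d il)}"

definition C_matrix ::
  "nat \<Rightarrow> nat \<Rightarrow> nat list \<Rightarrow> 'a::{comm_ring,comm_monoid_mult} bivec set \<Rightarrow> 'a mat" where
  "C_matrix r d il V =
     mat_of_cols d (map (quotient_coords V (chosen_monomials d il)) (all_monomials r d))"

text \<open>
  Position in the whole matrix of the first column of block \<open>m\<close> outside the identity submatrix:
  blocks have \<open>d + 1\<close> columns, and the first \<open>i\<^sub>m\<close> columns (none if \<open>m > s\<close>) are in the submatrix.
\<close>

definition first_free_column :: "nat \<Rightarrow> nat list \<Rightarrow> nat \<Rightarrow> nat" where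
  "first_free_column d il m = m * (d + 1) + (if m < length il then il ! m else 0)"


section \<open>Affine space and the chart\<close>

text \<open>The polynomial ring \<open>k[w\<^sub>v | v \<in> X]\<close>, and the \<open>k\<close>-algebra homomorphisms from it to \<open>A\<close>.\<close>

definition poly_ring :: "'v set \<Rightarrow> (('v \<Rightarrow>\<^sub>0 nat) \<Rightarrow>\<^sub>0 'k::field) set" where
  "poly_ring X = {p. \<forall>t \<in> Poly_Mapping.keys p. Poly_Mapping.keys t \<subseteq> X}"

definition poly_var :: "'v \<Rightarrow> ('v \<Rightarrow>\<^sub>0 nat) \<Rightarrow>\<^sub>0 'k::field" where
  "poly_var v = Poly_Mapping.single (Poly_Mapping.single v 1) 1"

definition Spec_poly_ring_points ::
  "('k::field \<Rightarrow> 'a::{comm_ring,comm_monoid_mult}) \<Rightarrow> 'v set \<Rightarrow>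
     ((('v \<Rightarrow>\<^sub>0 nat) \<Rightarrow>\<^sub>0 'k) \<Rightarrow> 'a) set" where
  "Spec_poly_ring_points \<iota> X =
     {g \<in> extensional (poly_ring X).
        (\<forall>c. g (Poly_Mapping.single 0 c) = \<iota> c) \<and>
        (\<forall>p\<in>poly_ring X. \<forall>q\<in>poly_ring X. g (p + q) = g p + g q \<and> g (p * q) = g p * g q)}"

definition eval_hom ::
  "('k::field \<Rightarrow> 'a::{comm_ring,comm_monoid_mult}) \<Rightarrow> 'v set \<Rightarrow> ('v \<Rightarrow> 'a) \<Rightarrow>
     (('v \<Rightarrow>\<^sub>0 nat) \<Rightarrow>\<^sub>0 'k) \<Rightarrow> 'a" where
  "eval_hom \<iota> X z =
     (\<lambda>p \<in> poly_ring X. \<Sum>t \<in> Poly_Mapping.keys p.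
        \<iota> (Poly_Mapping.lookup p t) *
        (\<Prod>v \<in> Poly_Mapping.keys t. z v ^ Poly_Mapping.lookup t v))"

abbreviation w_indices :: "nat \<Rightarrow> nat \<Rightarrow> (nat \<times> nat) set" where
  "w_indices r d \<equiv> {..<d} \<times> {..<r}"

text \<open>
  The map on \<open>A\<close>-points \<open>\<bbbQ>(A) \<rightarrow> \<bbbA>\<^sup>d\<^sup>r(A)\<close> sending \<open>V\<close> to the homomorphism which substitutes the
  entry in row \<open>h\<close> of the chosen column of block \<open>m\<close> for \<open>w\<^sub>h\<^sub>,\<^sub>m\<close>.
\<close>

definition phi ::
  "('k::field \<Rightarrow> 'a::{comm_ring,comm_monoid_mult}) \<Rightarrow> nat \<Rightarrow> nat \<Rightarrow> nat list \<Rightarrow> 'a bivec set \<Rightarrow>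
     (((nat \<times> nat) \<Rightarrow>\<^sub>0 nat) \<Rightarrow>\<^sub>0 'k) \<Rightarrow> 'a" where
  "phi \<iota> r d il V =
     eval_hom \<iota> (w_indices r d) (\<lambda>(h, m). C_matrix r d il V $$ (h, first_free_column d il m))"

end

theory Submission
  imports Defs "Jordan_Normal_Form.Determinant"
begin

text \<open>
  The key observation is that the quotient belonging to a point of the chart is supported on the
  affine line \<open>x \<noteq> 0\<close>.  The chosen
  monomials \<open>x\<^sup>d\<^sup>-\<^sup>jy\<^sup>je\<^sub>m\<close> have \<open>j < i\<^sub>m \<le> d\<close>, so all of them are divisible by \<open>x\<close>.  Hence, if they generate
  the degree \<open>d\<close> component of \<open>F/V\<close>, multiplication by \<open>x\<close> maps the component of each degree
  \<open>n \<ge> d\<close> onto the next one (\<open>generators_in_degree\<close>).  All these components are locally free of the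
  same rank \<open>d\<close>, and \<open>d\<close> generators of a locally free module of rank \<open>d\<close> form a basis
  (\<open>generators_are_basis\<close>).  Therefore multiplication by \<open>x\<close> is bijective in degrees \<open>\<ge> d\<close>, and the
  monomials \<open>x\<^sup>n\<^sup>-\<^sup>jy\<^sup>je\<^sub>m\<close> with \<open>j < i\<^sub>m\<close> are a basis in every degree \<open>n \<ge> d\<close>.

  Put \<open>x = 1\<close> and \<open>y = t\<close>.  The quotient becomes an \<open>A[t]\<close>-module that is free over \<open>A\<close> on the
  elements \<open>t\<^sup>je\<^sub>m\<close> with \<open>j < i\<^sub>m\<close>, and in it \<open>t\<close> maps each of them to the next, except that the image
  of the last one of block \<open>m\<close> is \<open>t\<^bsup>i\<^sub>m\<^esup>e\<^sub>m\<close>.  The coordinates of the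
  elements \<open>t\<^bsup>i\<^sub>m\<^esup>e\<^sub>m\<close>, together with those of \<open>e\<^sub>m\<close> for the blocks without chosen monomials, are exactly
  the entries of the first columns outside the identity submatrix.  They determine the action of
  \<open>t\<close> and the images of all \<open>e\<^sub>m\<close>, hence the kernel of \<open>A[t]\<^sup>r \<rightarrow> A\<^sup>d\<close>, hence \<open>V\<close> in degrees \<open>\<ge> d\<close>, and
  by saturation in all degrees (\<open>V_eq_chart_module\<close>).

  Conversely, arbitrary entries define an endomorphism of \<open>A\<^sup>d\<close> and the images of the \<open>e\<^sub>m\<close>, and so a
  homomorphism \<open>A[t]\<^sup>r \<rightarrow> A\<^sup>d\<close>.  The vectors all of whose homogeneous components are mapped to \<open>0\<close> form
  a point of the chart with the given columns (\<open>chart_module_in_Q_points\<close>,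
  \<open>chart_coords_chart_module\<close>).  This construction is compatible with base change
  (\<open>base_change_chart_module\<close>), since the image of \<open>V\<close> contains enough relations to rewrite every
  monomial of degree \<open>\<ge> d\<close> in terms of the basis.  What remains is the universal property of the
  polynomial ring.
\<close>

section \<open>Coefficients of vectors of polynomials\<close>

lemma lookup_monomial_mult:
  fixes q :: "'a::{comm_ring,comm_monoid_mult} bipoly"
  shows "Poly_Mapping.lookup (Poly_Mapping.single (a, b) c * q) (i, j) =
    (if a \<le> i \<and> b \<le> j then c * Poly_Mapping.lookup q (i - a, j - b) else 0)"
proof -
  have "Poly_Mapping.lookup (Poly_Mapping.single (a, b) c * q) (i, j) =
      c * Sum_any (\<lambda>k. Poly_Mapping.lookup q k when (i, j) = (a, b) + k)"
    by (simp add: lookup_mult lookup_single when_mult)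
  also have "(\<lambda>k. Poly_Mapping.lookup q k when (i, j) = (a, b) + k) =
      (\<lambda>k. (Poly_Mapping.lookup q (i - a, j - b) when a \<le> i \<and> b \<le> j) when k = (i - a, j - b))"
    by (rule ext) (auto simp: when_def)
  finally show ?thesis
    by (simp add: when_def)
qed

lemma lookup_const_mult:
  fixes q :: "'a::{comm_ring,comm_monoid_mult} bipoly"
  shows "Poly_Mapping.lookup (const c * q) k = c * Poly_Mapping.lookup q k"
  by (cases k) (simp add: lookup_monomial_mult)

lemma const_mult_monomial:
  "const c * Poly_Mapping.single k d = Poly_Mapping.single k (c * d)"
  by (simp add: mult_single flip: zero_prod_def)

lemma const_one_mult: "const 1 * q = q"
  by (rule poly_mapping_eqI) (simp add: lookup_const_mult)

lemma const_mult_assoc: "const (a * b) * q = const a * (const b * q)"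
  by (rule poly_mapping_eqI) (simp add: lookup_const_mult mult.assoc)

lemma const_sum: "const (\<Sum>i\<in>I. g i) = (\<Sum>i\<in>I. const (g i))"
  by (induction I rule: infinite_finite_induct) (simp_all add: single_add)

lemma lookup_hom_component:
  "Poly_Mapping.lookup (hom_component n f m) (a, b) =
     (if a + b = n then Poly_Mapping.lookup (f m) (a, b) else 0)"
proof -
  have "Poly_Mapping.lookup (hom_component n f m) (a, b) =
      (\<Sum>j\<le>n. if j = b then (if a + b = n then Poly_Mapping.lookup (f m) (a, b) else 0) else 0)"
    unfolding hom_component_def lookup_sum
    by (rule sum.cong) (auto simp: lookup_single when_def)
  then show ?thesis
    by auto
qed

lemma free_module_deg_iff:
  "f \<in> free_module_deg r n \<longleftrightarrow> f \<in> free_module r \<and>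
     (\<forall>m a b. a + b \<noteq> n \<longrightarrow> Poly_Mapping.lookup (f m) (a, b) = 0)"
  unfolding free_module_deg_def by (fastforce simp: in_keys_iff)

lemma smult_mem_free_module: "f \<in> free_module r \<Longrightarrow> smult_vec p f \<in> free_module r"
  by (simp add: free_module_def smult_vec_def)

lemma hom_component_in_free_module_deg:
  "f \<in> free_module r \<Longrightarrow> hom_component n f \<in> free_module_deg r n"
  by (auto simp: free_module_deg_iff lookup_hom_component) (simp add: free_module_def hom_component_def)

lemma hom_component_of_homogeneous:
  "f \<in> free_module_deg r n \<Longrightarrow> hom_component n f = f"
  by (intro ext poly_mapping_eqI) (auto simp: free_module_deg_iff lookup_hom_component)

lemma monomial_vec_in_free_module_deg:
  assumes "m < r" "j \<le> n"
  shows "monomial_vec n m j \<in> free_module_deg r n"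
  using assms
  by (auto simp: free_module_deg_iff free_module_def monomial_vec_def lookup_single when_def)

lemma smult_monomial_vec:
  assumes "j \<le> n"
  shows "smult_vec (xy a b) (monomial_vec n m j) = monomial_vec (n + a + b) m (j + b)"
  using assms by (auto simp: smult_vec_def monomial_vec_def mult_single add.commute)

lemma smult_xy_in_free_module_deg:
  "f \<in> free_module_deg r n \<Longrightarrow> smult_vec (xy a b) f \<in> free_module_deg r (n + a + b)"
  by (auto simp: free_module_deg_iff free_module_def smult_vec_def lookup_monomial_mult)

lemma homogeneous_expansion:
  assumes "f \<in> free_module_deg r n"
  shows "f = (\<lambda>m'. \<Sum>m<r. \<Sum>j\<le>n.
    const (Poly_Mapping.lookup (f m) (n - j, j)) * monomial_vec n m j m')"
proof
  fix m'
  have "(\<Sum>m<r. \<Sum>j\<le>n. const (Poly_Mapping.lookup (f m) (n - j, j)) * monomial_vec n m j m') =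
      (\<Sum>m<r. if m = m' then hom_component n f m' else 0)"
    by (rule sum.cong) (auto simp: monomial_vec_def hom_component_def const_mult_monomial)
  also have "\<dots> = (if m' < r then hom_component n f m' else 0)"
    by simp
  also have "\<dots> = f m'"
    using assms by (auto simp: hom_component_of_homogeneous free_module_deg_iff free_module_def)
  finally show "f m' = (\<Sum>m<r. \<Sum>j\<le>n.
      const (Poly_Mapping.lookup (f m) (n - j, j)) * monomial_vec n m j m')" ..
qed

lemma hom_component_expansion:
  assumes "f \<in> free_module r"
  obtains D where "f = (\<lambda>m. \<Sum>n<D. hom_component n f m)"
proof -
  let ?K = "(\<lambda>(a, b). a + b) ` (\<Union>m<r. Poly_Mapping.keys (f m))"
  have "finite ?K" by simp
  then obtain D where D: "\<And>k. k \<in> ?K \<Longrightarrow> k < D"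
    unfolding finite_nat_set_iff_bounded by blast
  have "f m = (\<Sum>n<D. hom_component n f m)" for m
  proof (rule poly_mapping_eqI)
    fix k :: "nat \<times> nat"
    obtain a b where k: "k = (a, b)" by fastforce
    have "a + b < D" if "Poly_Mapping.lookup (f m) (a, b) \<noteq> 0"
    proof (rule D)
      have "m < r"
        using that assms by (auto simp: free_module_def not_less intro: ccontr)
      then have "(a, b) \<in> (\<Union>m<r. Poly_Mapping.keys (f m))"
        using that by (auto simp: in_keys_iff)
      then show "a + b \<in> ?K" by (rule rev_image_eqI) simp
    qed
    then show "Poly_Mapping.lookup (f m) k = Poly_Mapping.lookup (\<Sum>n<D. hom_component n f m) k"
      by (auto simp: k lookup_sum lookup_hom_component)
  qed
  then show thesis by (intro that ext)
qed

lemma poly_mapping_as_sum_of_monomials: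
  "p = (\<Sum>k\<in>Poly_Mapping.keys p. Poly_Mapping.single k (Poly_Mapping.lookup p k))"
  by (rule poly_mapping_eqI) (auto simp: lookup_sum lookup_single when_def in_keys_iff)

section \<open>Congruences modulo a submodule\<close>

definition congruent_mod :: "'a::{comm_ring,comm_monoid_mult} bivec set \<Rightarrow> 'a bivec \<Rightarrow> 'a bivec \<Rightarrow> bool" where
  "congruent_mod V f g \<longleftrightarrow> (\<lambda>m. f m - g m) \<in> V"

locale submodule_of_free =
  fixes r :: nat and V :: "'a::{comm_ring,comm_monoid_mult} bivec set"
  assumes submodule: "is_submodule r V"
begin

lemma zero_mem: "(\<lambda>m. 0) \<in> V"
  and add_mem: "f \<in> V \<Longrightarrow> g \<in> V \<Longrightarrow> (\<lambda>m. f m + g m) \<in> V"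
  and smult_mem: "f \<in> V \<Longrightarrow> smult_vec p f \<in> V"
  using submodule by (auto simp: is_submodule_def)

lemma uminus_mem: "f \<in> V \<Longrightarrow> (\<lambda>m. - f m) \<in> V"
  using smult_mem[of f "const (-1)"]
  by (simp add: smult_vec_def single_uminus const_one_mult)

lemma sum_mem: "(\<And>i. i \<in> I \<Longrightarrow> g i \<in> V) \<Longrightarrow> (\<lambda>m. \<Sum>i\<in>I. g i m) \<in> V"
  by (induction I rule: infinite_finite_induct) (auto simp: zero_mem add_mem)

lemma cong_refl: "congruent_mod V f f"
  by (simp add: congruent_mod_def zero_mem)

lemma cong_sym: "congruent_mod V f g \<Longrightarrow> congruent_mod V g f"
  using uminus_mem by (fastforce simp: congruent_mod_def)

lemma cong_trans [trans]:
  "congruent_mod V f g \<Longrightarrow> congruent_mod V g h \<Longrightarrow> congruent_mod V f h"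
  using add_mem[of "\<lambda>m. f m - g m" "\<lambda>m. g m - h m"] by (simp add: congruent_mod_def)

lemma cong_smult: "congruent_mod V f g \<Longrightarrow> congruent_mod V (smult_vec p f) (smult_vec p g)"
  using smult_mem[of "\<lambda>m. f m - g m" p]
  by (simp add: congruent_mod_def smult_vec_def right_diff_distrib)

lemma cong_sum:
  "(\<And>i. i \<in> I \<Longrightarrow> congruent_mod V (f i) (g i)) \<Longrightarrow>
     congruent_mod V (\<lambda>m. \<Sum>i\<in>I. f i m) (\<lambda>m. \<Sum>i\<in>I. g i m)"
  using sum_mem[of I "\<lambda>i m. f i m - g i m"] by (simp add: congruent_mod_def sum_subtractf)

lemma cong_mem_iff: "congruent_mod V f g \<Longrightarrow> f \<in> V \<longleftrightarrow> g \<in> V"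
proof -
  have zero: "congruent_mod V h (\<lambda>m. 0) \<longleftrightarrow> h \<in> V" for h
    by (simp add: congruent_mod_def)
  show "congruent_mod V f g \<Longrightarrow> f \<in> V \<longleftrightarrow> g \<in> V"
    using cong_trans cong_sym zero by metis
qed

end

section \<open>Linear combinations\<close>

text \<open>
  Coordinates are functions here, of which only the values below the number of vectors matter.
  Compared with coordinates in \<open>carrier_vec\<close>, sums and multiples of coordinates need no side
  conditions.
\<close>

definition comb :: "(nat \<Rightarrow> 'a::{comm_ring,comm_monoid_mult}) \<Rightarrow> 'a bivec list \<Rightarrow> 'a bivec" where
  "comb c bs = (\<lambda>m. \<Sum>h<length bs. const (c h) * (bs ! h) m)"

lemma lin_comb_eq_comb: "lin_comb c bs = comb (($) c) bs"
  by (simp add: lin_comb_def comb_def)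

lemma lin_comb_vec: "lin_comb (vec (length bs) c) bs = comb c bs"
  by (simp add: lin_comb_def comb_def)

lemma comb_cong: "(\<And>h. h < length bs \<Longrightarrow> c h = c' h) \<Longrightarrow> comb c bs = comb c' bs"
  by (simp add: comb_def)

lemma comb_diff: "(\<lambda>m. comb c bs m - comb c' bs m) = comb (\<lambda>h. c h - c' h) bs"
  by (simp add: comb_def single_diff left_diff_distrib sum_subtractf)

lemma comb_smult: "smult_vec (const s) (comb c bs) = comb (\<lambda>h. s * c h) bs"
  by (simp add: comb_def smult_vec_def sum_distrib_left const_mult_assoc)

lemma comb_unit: "k < length bs \<Longrightarrow> comb (\<lambda>h. if h = k then 1 else 0) bs = bs ! k"
proof
  fix m
  assume "k < length bs"
  have "comb (\<lambda>h. if h = k then 1 else 0) bs m = (\<Sum>h<length bs. if h = k then (bs ! k) m else 0)"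
    unfolding comb_def by (rule sum.cong) (auto simp: const_one_mult)
  then show "comb (\<lambda>h. if h = k then 1 else 0) bs m = (bs ! k) m"
    using \<open>k < length bs\<close> by simp
qed

lemma comb_sum:
  "(\<lambda>m. \<Sum>i\<in>I. const (c i) * comb (t i) bs m) = comb (\<lambda>h. \<Sum>i\<in>I. c i * t i h) bs"
proof
  fix m
  have "(\<Sum>i\<in>I. const (c i) * comb (t i) bs m) =
      (\<Sum>i\<in>I. \<Sum>h<length bs. const (c i * t i h) * (bs ! h) m)"
    by (simp add: comb_def sum_distrib_left const_mult_assoc)
  also have "\<dots> = (\<Sum>h<length bs. \<Sum>i\<in>I. const (c i * t i h) * (bs ! h) m)"
    by (rule sum.swap)
  also have "\<dots> = comb (\<lambda>h. \<Sum>i\<in>I. c i * t i h) bs m"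
    by (simp add: comb_def const_sum sum_distrib_right)
  finally show "(\<Sum>i\<in>I. const (c i) * comb (t i) bs m) = comb (\<lambda>h. \<Sum>i\<in>I. c i * t i h) bs m" .
qed

lemma smult_comb:
  "smult_vec p (comb c bs) = (\<lambda>m. \<Sum>h<length bs. const (c h) * smult_vec p (bs ! h) m)"
  by (simp add: comb_def smult_vec_def sum_distrib_left mult.left_commute)

lemma ex_coords_iff:
  "(\<exists>c\<in>carrier_vec (length bs). Q (lin_comb c bs)) \<longleftrightarrow> (\<exists>c. Q (comb c bs))"
proof
  show "\<exists>c. Q (comb c bs)" if "\<exists>c\<in>carrier_vec (length bs). Q (lin_comb c bs)"
    using that by (auto simp: lin_comb_eq_comb)
  show "\<exists>c\<in>carrier_vec (length bs). Q (lin_comb c bs)" if ex: "\<exists>c. Q (comb c bs)"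
  proof -
    from ex obtain c where "Q (comb c bs)" ..
    then have "Q (lin_comb (vec (length bs) c) bs)" by (simp add: lin_comb_vec)
    then show ?thesis by (rule bexI) simp
  qed
qed

lemma all_coords_iff:
  "(\<forall>c\<in>carrier_vec (length bs). Q (lin_comb c bs) \<longrightarrow> (\<forall>h<length bs. R (c $ h))) \<longleftrightarrow>
     (\<forall>c. Q (comb c bs) \<longrightarrow> (\<forall>h<length bs. R (c h)))"
proof
  assume *: "\<forall>c\<in>carrier_vec (length bs). Q (lin_comb c bs) \<longrightarrow> (\<forall>h<length bs. R (c $ h))"
  show "\<forall>c. Q (comb c bs) \<longrightarrow> (\<forall>h<length bs. R (c h))"
  proof (intro allI impI)
    fix c h
    assume "Q (comb c bs)" "h < length bs"
    then show "R (c h)"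
      using bspec[OF *, of "vec (length bs) c"] by (simp add: lin_comb_vec)
  qed
next
  assume "\<forall>c. Q (comb c bs) \<longrightarrow> (\<forall>h<length bs. R (c h))"
  then show "\<forall>c\<in>carrier_vec (length bs). Q (lin_comb c bs) \<longrightarrow> (\<forall>h<length bs. R (c $ h))"
    by (simp add: lin_comb_eq_comb)
qed

lemma is_quotient_basis_iff:
  "is_quotient_basis N V bs \<longleftrightarrow> set bs \<subseteq> N \<and>
     (\<forall>f\<in>N. \<exists>c. congruent_mod V f (comb c bs)) \<and>
     (\<forall>c. comb c bs \<in> V \<longrightarrow> (\<forall>h<length bs. c h = 0))"
  unfolding is_quotient_basis_def congruent_mod_def
  using all_coords_iff[of bs "\<lambda>g. g \<in> V" "\<lambda>a. a = 0"]
  by (simp add: ex_coords_iff[of bs "\<lambda>g. (\<lambda>m. _ m - g m) \<in> V"])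

lemma is_localized_quotient_basis_iff:
  "is_localized_quotient_basis s N V bs \<longleftrightarrow> set bs \<subseteq> N \<and>
     (\<forall>f\<in>N. \<exists>p c. congruent_mod V (smult_vec (const (s ^ p)) f) (comb c bs)) \<and>
     (\<forall>c p. smult_vec (const (s ^ p)) (comb c bs) \<in> V \<longrightarrow> (\<forall>h<length bs. \<exists>q. s ^ q * c h = 0))"
  unfolding is_localized_quotient_basis_def congruent_mod_def
  using all_coords_iff[of bs "\<lambda>g. \<exists>p. smult_vec (const (s ^ p)) g \<in> V" "\<lambda>a. \<exists>q. s ^ q * a = 0"]
  by (simp add: ex_coords_iff[of bs "\<lambda>g. (\<lambda>m. _ m - g m) \<in> V"] smult_vec_def[of _ "_ :: _ \<Rightarrow> _ bipoly"])

text \<open>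
  The cover of \<open>Spec A\<close> by the single open set \<open>D(1)\<close>.
\<close>

lemma is_quotient_basis_locally_free:
  assumes "is_quotient_basis N V bs"
  shows "locally_free_quotient (length bs) N V"
  unfolding locally_free_quotient_def
proof (intro exI conjI ballI)
  show "finite {1 :: 'a}" "(\<Sum>s\<in>{1 :: 'a}. s * s) = 1" by simp_all
  show "is_localized_quotient_basis s N V bs" if "s \<in> {1}" for s
    using that assms
    by (simp add: is_localized_quotient_basis_iff is_quotient_basis_iff smult_vec_def[of "const 1"] const_one_mult)
qed simp

context submodule_of_free
begin

lemma cong_weighted_sum:
  assumes "\<And>i. i \<in> I \<Longrightarrow> congruent_mod V (g i) (comb (t i) bs)"
  shows "congruent_mod V (\<lambda>m. \<Sum>i\<in>I. const (a i) * g i m) (comb (\<lambda>h. \<Sum>i\<in>I. a i * t i h) bs)"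
proof -
  have "congruent_mod V (\<lambda>m. \<Sum>i\<in>I. const (a i) * g i m) (\<lambda>m. \<Sum>i\<in>I. const (a i) * comb (t i) bs m)"
    using cong_smult[OF assms] by (intro cong_sum) (simp add: smult_vec_def)
  then show ?thesis by (simp add: comb_sum)
qed

lemma quotient_coords_eq:
  assumes "is_quotient_basis N V bs" "congruent_mod V f (comb c bs)" "h < length bs"
  shows "quotient_coords V bs f $ h = c h"
proof -
  have "quotient_coords V bs f = vec (length bs) c"
    unfolding quotient_coords_def
  proof (rule the_equality)
    show "vec (length bs) c \<in> carrier_vec (length bs) \<and>
        (\<lambda>m. f m - lin_comb (vec (length bs) c) bs m) \<in> V"
      using assms(2) by (simp add: lin_comb_vec congruent_mod_def)
  next
    fix c' :: "'a vec"
    assume c': "c' \<in> carrier_vec (length bs) \<and> (\<lambda>m. f m - lin_comb c' bs m) \<in> V"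
    then have "congruent_mod V f (comb (($) c') bs)"
      by (simp add: lin_comb_eq_comb congruent_mod_def)
    then have "congruent_mod V (comb (($) c') bs) (comb c bs)"
      using assms(2) cong_sym cong_trans by blast
    then have "comb (\<lambda>h. c' $ h - c h) bs \<in> V"
      by (simp add: congruent_mod_def comb_diff)
    then have "c' $ h = c h" if "h < length bs" for h
      using assms(1) that by (fastforce simp: is_quotient_basis_iff)
    then show "c' = vec (length bs) c"
      using c' by (intro eq_vecI) auto
  qed
  then show ?thesis using assms(3) by simp
qed

end

section \<open>Generators of the right number form a basis\<close>

text \<open>
  The type class over which determinants are defined has \<open>0 \<noteq> 1\<close>, whereas \<open>A\<close> may be the zero ring.  The product ring
  \<open>A \<times> \<int>\<close> is never zero, and an identity \<open>s\<^sup>aPQ = s\<^sup>b\<close> between matrices over \<open>A\<close> lifts to it: take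
  the identity matrix as second component of \<open>P\<close> and \<open>Q\<close>, and \<open>1\<close> as second component of \<open>s\<close>.
\<close>

datatype 'a with_int = With_int (ring_part: 'a) (int_part: int)

instantiation with_int :: ("{comm_ring,comm_monoid_mult}") comm_ring_1
begin

definition "0 = With_int 0 0"
definition "1 = With_int 1 1"
definition "x + y = With_int (ring_part x + ring_part y) (int_part x + int_part y)"
definition "x - y = With_int (ring_part x - ring_part y) (int_part x - int_part y)"
definition "- x = With_int (- ring_part x) (- int_part x)"
definition "x * y = With_int (ring_part x * ring_part y) (int_part x * int_part y)"

instance
  by standard (simp_all add: zero_with_int_def one_with_int_def plus_with_int_def
      minus_with_int_def uminus_with_int_def times_with_int_def distrib_right distrib_left ac_simps)

end

lemma part_simps:
  "ring_part 0 = 0" "int_part 0 = 0" "ring_part 1 = 1" "int_part 1 = 1"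
  "ring_part (x + y) = ring_part x + ring_part y" "int_part (x + y) = int_part x + int_part y"
  "ring_part (x * y) = ring_part x * ring_part y" "int_part (x * y) = int_part x * int_part y"
  by (simp_all add: zero_with_int_def one_with_int_def plus_with_int_def times_with_int_def)

lemma part_power: "ring_part (x ^ n) = ring_part x ^ n" "int_part (x ^ n) = int_part x ^ n"
  by (induction n) (simp_all add: part_simps)

lemma part_sum:
  "ring_part (\<Sum>i\<in>I. g i) = (\<Sum>i\<in>I. ring_part (g i))"
  "int_part (\<Sum>i\<in>I. g i) = (\<Sum>i\<in>I. int_part (g i))"
  by (induction I rule: infinite_finite_induct) (simp_all add: part_simps)

text \<open>
  If \<open>PQ\<close> is invertible after inverting \<open>s\<close>, then so is \<open>Q\<close>: its determinant divides a power of
  \<open>s\<close>.  Multiplying \<open>s\<^sup>ecQ = 0\<close> by the adjugate of \<open>Q\<close> gives \<open>s\<^sup>ec det Q = 0\<close>, and a further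
  multiplication by \<open>det (s\<^sup>aP)\<close> turns \<open>det Q\<close> into a power of \<open>s\<close>.
\<close>

lemma cancel_matrix_invertible_up_to_power_nonzero_ring:
  fixes P Q :: "nat \<Rightarrow> nat \<Rightarrow> 'a::comm_ring_1"
  assumes PQ: "\<And>i k. i < n \<Longrightarrow> k < n \<Longrightarrow> s ^ a * (\<Sum>j<n. P i j * Q j k) = (if i = k then s ^ b else 0)"
    and cQ: "\<And>k. k < n \<Longrightarrow> s ^ e * (\<Sum>j<n. c j * Q j k) = 0"
    and "j < n"
  shows "s ^ (b * n + e) * c j = 0"
proof -
  define P' where "P' = mat n n (\<lambda>(i, j). s ^ a * P i j)"
  define Q' where "Q' = mat n n (\<lambda>(i, j). Q i j)"
  define J where "J = adj_mat Q'"
  have carr: "P' \<in> carrier_mat n n" "Q' \<in> carrier_mat n n"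
    by (auto simp: P'_def Q'_def)
  have J: "J \<in> carrier_mat n n" "Q' * J = det Q' \<cdot>\<^sub>m 1\<^sub>m n"
    using adj_mat[OF carr(2)] by (auto simp: J_def)
  have "P' * Q' = s ^ b \<cdot>\<^sub>m 1\<^sub>m n"
  proof (rule eq_matI)
    fix i k assume "i < dim_row (s ^ b \<cdot>\<^sub>m 1\<^sub>m n)" "k < dim_col (s ^ b \<cdot>\<^sub>m 1\<^sub>m n)"
    then have "i < n" "k < n" by auto
    then have "(P' * Q') $$ (i, k) = (\<Sum>j<n. s ^ a * P i j * Q j k)"
      by (simp add: P'_def Q'_def scalar_prod_def atLeast0LessThan)
    also have "\<dots> = (if i = k then s ^ b else 0)"
      using PQ[OF \<open>i < n\<close> \<open>k < n\<close>] by (simp add: sum_distrib_left mult.assoc)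
    finally show "(P' * Q') $$ (i, k) = (s ^ b \<cdot>\<^sub>m 1\<^sub>m n) $$ (i, k)"
      using \<open>i < n\<close> \<open>k < n\<close> by simp
  qed (auto simp: P'_def Q'_def)
  then have det: "det P' * det Q' = s ^ (b * n)"
    using det_mult[OF carr] by (simp add: power_mult)
  have QJ: "(\<Sum>k<n. Q i k * J $$ (k, j)) = (if i = j then det Q' else 0)" if "i < n" for i
  proof -
    have "(Q' * J) $$ (i, j) = (\<Sum>k<n. Q i k * J $$ (k, j))"
      using that \<open>j < n\<close> J(1) by (simp add: Q'_def scalar_prod_def atLeast0LessThan)
    then show ?thesis
      using that \<open>j < n\<close> by (cases "i = j") (simp_all add: J(2))
  qed
  have "0 = (\<Sum>k<n. (s ^ e * (\<Sum>i<n. c i * Q i k)) * J $$ (k, j))"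
    by (simp add: cQ)
  also have "\<dots> = s ^ e * (\<Sum>k<n. \<Sum>i<n. c i * (Q i k * J $$ (k, j)))"
    by (simp add: sum_distrib_left sum_distrib_right mult.assoc)
  also have "\<dots> = s ^ e * (\<Sum>i<n. c i * (\<Sum>k<n. Q i k * J $$ (k, j)))"
    by (subst sum.swap) (simp add: sum_distrib_left)
  also have "(\<Sum>i<n. c i * (\<Sum>k<n. Q i k * J $$ (k, j))) = (\<Sum>i<n. if i = j then c i * det Q' else 0)"
    by (rule sum.cong) (auto simp: QJ)
  also have "\<dots> = c j * det Q'"
    using \<open>j < n\<close> by simp
  finally have "s ^ e * c j * det Q' = 0"
    by (simp add: mult.assoc)
  then have "det P' * (s ^ e * c j * det Q') = 0" by simp
  then show ?thesis
    by (simp add: power_add flip: det) (simp add: ac_simps)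
qed

lemma cancel_matrix_invertible_up_to_power:
  fixes P Q :: "nat \<Rightarrow> nat \<Rightarrow> 'a::{comm_ring,comm_monoid_mult}"
  assumes PQ: "\<And>i k. i < n \<Longrightarrow> k < n \<Longrightarrow> s ^ a * (\<Sum>j<n. P i j * Q j k) = (if i = k then s ^ b else 0)"
    and cQ: "\<And>k. k < n \<Longrightarrow> s ^ e * (\<Sum>j<n. c j * Q j k) = 0"
    and "j < n"
  shows "s ^ (b * n + e) * c j = 0"
proof -
  define P' where "P' i j = With_int (P i j) (if i = j then 1 else 0)" for i j
  define Q' where "Q' i j = With_int (Q i j) (if i = j then 1 else 0)" for i j
  have "With_int s 1 ^ (b * n + e) * With_int (c j) 0 = 0"
  proof (rule cancel_matrix_invertible_up_to_power_nonzero_ring[of n _ a P' Q' b e "\<lambda>j. With_int (c j) 0", OF _ _ \<open>j < n\<close>])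
    fix i k assume *: "i < n" "k < n"
    have "(\<Sum>j<n. (if i = j then 1 else 0) * (if j = k then 1 else 0)) =
       (\<Sum>j<n. if j = i then (if i = k then 1 else 0) else (0::int))"
      by (rule sum.cong) auto
    then have "(\<Sum>j<n. (if i = j then 1 else 0) * (if j = k then 1 else 0)) = (if i = k then 1 else (0::int))"
      using * by simp
    then show "With_int s 1 ^ a * (\<Sum>j<n. P' i j * Q' j k) = (if i = k then With_int s 1 ^ b else 0)"
      using PQ[OF *] by (intro with_int.expand) (simp add: part_simps part_power part_sum P'_def Q'_def)
  next
    fix k assume "k < n"
    then show "With_int s 1 ^ e * (\<Sum>j<n. With_int (c j) 0 * Q' j k) = 0"
      using cQ[of k] by (intro with_int.expand) (simp add: part_simps part_power part_sum Q'_def)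
  qed
  from arg_cong[OF this, of ring_part] show ?thesis
    by (simp add: part_simps part_power)
qed

text \<open>
  Induction on the sum of the exponents \<open>N s\<close> with \<open>s\<^bsup>N s\<^esup>c = 0\<close>.  If all of them are positive, the
  elements \<open>sc\<close> satisfy the hypothesis with one exponent lowered, so they vanish, and \<open>c\<close> is a linear
  combination of them.
\<close>

lemma zero_if_killed_locally:
  fixes c :: "'a::{comm_ring,comm_monoid_mult}"
  assumes "finite E" "(\<Sum>s\<in>E. u s * s) = 1" "\<And>s. s \<in> E \<Longrightarrow> \<exists>q. s ^ q * c = 0"
  shows "c = 0"
proof -
  obtain N where N: "\<And>s. s \<in> E \<Longrightarrow> s ^ N s * c = 0"
    using assms(3) by metis
  then show ?thesis
  proof (induction "\<Sum>s\<in>E. N s" arbitrary: N c rule: less_induct)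
    case (less N c)
    show ?case
    proof (cases "\<exists>s\<in>E. N s = 0")
      case True
      then show ?thesis using less.prems by fastforce
    next
      case False
      have "s * c = 0" if "s \<in> E" for s
      proof (rule less.hyps[of "N(s := N s - 1)"])
        show "sum (N(s := N s - 1)) E < sum N E"
          by (rule sum_strict_mono_ex1[OF assms(1)]) (use False that in auto)
        fix t assume "t \<in> E"
        show "t ^ (N(s := N s - 1)) t * (s * c) = 0"
        proof (cases "t = s")
          case True
          have "s ^ N s = s ^ (N s - 1) * s"
            using False that by (cases "N s") (auto simp: mult.commute)
          then show ?thesis
            using less.prems[OF that] True by (simp add: mult.assoc)
        next
          case False
          then show ?thesis
            using less.prems[OF \<open>t \<in> E\<close>] by (simp add: mult.left_commute[of _ s])
        qed
      qed
      then have "(\<Sum>s\<in>E. u s * s) * c = 0"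
        by (simp add: sum_distrib_right mult.assoc)
      then show ?thesis by (simp add: assms(2))
    qed
  qed
qed

lemma uniform_exponent:
  fixes x :: "nat \<Rightarrow> 'a::{comm_ring,comm_monoid_mult}"
  assumes "\<And>k. k < n \<Longrightarrow> \<exists>q. s ^ q * x k = 0"
  shows "\<exists>q. \<forall>k<n. s ^ q * x k = 0"
proof -
  obtain q where q: "\<And>k. k < n \<Longrightarrow> s ^ q k * x k = 0"
    using assms by metis
  have "s ^ (\<Sum>k<n. q k) * x k = 0" if "k < n" for k
  proof -
    have "(\<Sum>k<n. q k) = (\<Sum>j\<in>{..<n} - {k}. q j) + q k"
      using that by (simp add: sum.remove[of "{..<n}" k])
    then show ?thesis
      using q[OF that] by (simp add: power_add mult.assoc)
  qed
  then show ?thesis by blast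
qed

context submodule_of_free
begin

text \<open>
  Over \<open>A\<^sub>s\<close>, write the given generators in terms of a basis \<open>bs'\<close> (matrix \<open>Q\<close>) and \<open>bs'\<close> in terms of
  the generators (matrix \<open>P\<close>).  Then \<open>PQ\<close> is the identity because \<open>bs'\<close> is linearly independent, so
  \<open>Q\<close> is invertible and the generators are independent as well.  In terms of \<open>A\<close>, each of these
  identities holds after multiplication by a power of \<open>s\<close>.
\<close>

lemma generators_are_basis:
  assumes free: "locally_free_quotient n N V"
    and gens: "length bs = n" "set bs \<subseteq> N" "\<And>f. f \<in> N \<Longrightarrow> \<exists>c. congruent_mod V f (comb c bs)"
  shows "is_quotient_basis N V bs"
proof -
  have "c h = 0" if c: "comb c bs \<in> V" and "h < n" for c h
  proof -
    obtain E u where E: "finite E" "(\<Sum>s\<in>E. u s * s) = 1"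
      and loc: "\<And>s. s \<in> E \<Longrightarrow> \<exists>bs'. length bs' = n \<and> is_localized_quotient_basis s N V bs'"
      using free unfolding locally_free_quotient_def by blast
    have "\<exists>q. s ^ q * c h = 0" if "s \<in> E" for s
    proof -
      obtain bs' where bs': "length bs' = n" "set bs' \<subseteq> N"
        and gens': "\<And>f. f \<in> N \<Longrightarrow> \<exists>p c. congruent_mod V (smult_vec (const (s ^ p)) f) (comb c bs')"
        and indep': "\<And>c p h. smult_vec (const (s ^ p)) (comb c bs') \<in> V \<Longrightarrow> h < n \<Longrightarrow> \<exists>q. s ^ q * c h = 0"
        using loc[OF \<open>s \<in> E\<close>] unfolding is_localized_quotient_basis_iff by blast
      have "\<exists>c. congruent_mod V (bs' ! i) (comb c bs)" if "i < n" for i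
        using that bs' by (intro gens(3)) auto
      then obtain P where P: "\<And>i. i < n \<Longrightarrow> congruent_mod V (bs' ! i) (comb (P i) bs)"
        by metis
      have "\<exists>p c. congruent_mod V (smult_vec (const (s ^ p)) (bs ! j)) (comb c bs')" if "j < n" for j
        using that gens(1,2) by (intro gens') auto
      then obtain p R where R: "\<And>j. j < n \<Longrightarrow>
          congruent_mod V (smult_vec (const (s ^ p j)) (bs ! j)) (comb (R j) bs')"
        by metis
      \<comment> \<open>One power of \<open>s\<close> for all the generators.\<close>
      define t where "t = (\<Sum>j<n. p j)"
      define Q where "Q j k = s ^ (t - p j) * R j k" for j k
      have Q: "congruent_mod V (smult_vec (const (s ^ t)) (bs ! j)) (comb (Q j) bs')" if "j < n" for j
      proof -
        have "p j \<le> t"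
          unfolding t_def using that by (intro member_le_sum) auto
        then have "s ^ t = s ^ (t - p j) * s ^ p j"
          by (simp flip: power_add)
        then have "smult_vec (const (s ^ t)) (bs ! j) =
            smult_vec (const (s ^ (t - p j))) (smult_vec (const (s ^ p j)) (bs ! j))"
          by (simp add: smult_vec_def const_mult_assoc)
        with cong_smult[OF R[OF that], of "const (s ^ (t - p j))"] show ?thesis
          unfolding comb_smult Q_def[abs_def] by simp
      qed
      have Qcomb: "congruent_mod V (smult_vec (const (s ^ t)) (comb g bs))
          (comb (\<lambda>k. \<Sum>j<n. g j * Q j k) bs')" for g
      proof -
        have "congruent_mod V (\<lambda>m. \<Sum>j<n. const (g j) * smult_vec (const (s ^ t)) (bs ! j) m)
            (\<lambda>m. \<Sum>j<n. const (g j) * comb (Q j) bs' m)"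
        proof (rule cong_sum)
          fix j assume "j \<in> {..<n}"
          then show "congruent_mod V (\<lambda>m. const (g j) * smult_vec (const (s ^ t)) (bs ! j) m)
              (\<lambda>m. const (g j) * comb (Q j) bs' m)"
            using cong_smult[OF Q, of j "const (g j)"] by (simp add: smult_vec_def)
        qed
        then show ?thesis
          by (simp add: smult_comb comb_sum gens(1))
      qed
      have "\<exists>q. s ^ q * ((if i = k then s ^ t else 0) - (\<Sum>j<n. P i j * Q j k)) = 0"
        if "i < n" "k < n" for i k
      proof -
        have "congruent_mod V (comb (\<lambda>k. if i = k then s ^ t else 0) bs') (smult_vec (const (s ^ t)) (bs' ! i))"
        proof -
          have "smult_vec (const (s ^ t)) (bs' ! i) =
              comb (\<lambda>k. s ^ t * (if k = i then 1 else 0)) bs'"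
            using \<open>i < n\<close> bs'(1) by (simp add: comb_unit flip: comb_smult)
          moreover have "\<dots> = comb (\<lambda>k. if i = k then s ^ t else 0) bs'"
            by (rule comb_cong) auto
          ultimately show ?thesis by (simp add: cong_refl)
        qed
        also have "congruent_mod V \<dots> (smult_vec (const (s ^ t)) (comb (P i) bs))"
          by (rule cong_smult[OF P[OF \<open>i < n\<close>]])
        also have "congruent_mod V \<dots> (comb (\<lambda>k. \<Sum>j<n. P i j * Q j k) bs')"
          by (rule Qcomb)
        finally have "comb (\<lambda>k. (if i = k then s ^ t else 0) - (\<Sum>j<n. P i j * Q j k)) bs' \<in> V"
          by (simp add: congruent_mod_def comb_diff)
        then show ?thesis
          by (rule indep'[OF smult_mem \<open>k < n\<close>])
      qed
      then have "\<exists>q. \<forall>k<n. s ^ q * ((if i = k then s ^ t else 0) - (\<Sum>j<n. P i j * Q j k)) = 0"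
        if "i < n" for i
        using that by (intro uniform_exponent)
      then obtain q where q: "\<And>i k. i < n \<Longrightarrow> k < n \<Longrightarrow>
          s ^ q i * ((if i = k then s ^ t else 0) - (\<Sum>j<n. P i j * Q j k)) = 0"
        by metis
      \<comment> \<open>A common power of \<open>s\<close> for all entries of \<open>PQ\<close>.\<close>
      define a where "a = (\<Sum>i<n. q i)"
      have PQ: "s ^ a * (\<Sum>j<n. P i j * Q j k) = (if i = k then s ^ (a + t) else 0)"
        if "i < n" "k < n" for i k
      proof -
        have "q i \<le> a"
          unfolding a_def using that by (intro member_le_sum) auto
        then have "s ^ a = s ^ (a - q i) * s ^ q i"
          by (simp flip: power_add)
        then have "s ^ a * ((if i = k then s ^ t else 0) - (\<Sum>j<n. P i j * Q j k)) = 0"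
          using q[OF that] by (simp add: mult.assoc)
        then show ?thesis
          by (auto simp: right_diff_distrib power_add split: if_splits)
      qed
      have "comb (\<lambda>k. \<Sum>j<n. c j * Q j k) bs' \<in> V"
        using cong_mem_iff[OF Qcomb] smult_mem[OF c] by blast
      from smult_mem[OF this, of "const (s ^ 0)"]
      have "\<exists>e. s ^ e * (\<Sum>j<n. c j * Q j k) = 0" if "k < n" for k
        using indep'[of 0 "\<lambda>k. \<Sum>j<n. c j * Q j k" k] that by blast
      then obtain e where e: "\<And>k. k < n \<Longrightarrow> s ^ e * (\<Sum>j<n. c j * Q j k) = 0"
        using uniform_exponent[of n s "\<lambda>k. \<Sum>j<n. c j * Q j k"] by blast
      have "s ^ ((a + t) * n + e) * c h = 0"
        by (rule cancel_matrix_invertible_up_to_power[OF PQ e \<open>h < n\<close>])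
      then show ?thesis ..
    qed
    then show ?thesis
      by (rule zero_if_killed_locally[OF E])
  qed
  then show ?thesis
    unfolding is_quotient_basis_iff using gens by blast
qed

end

section \<open>The quotient with prescribed columns\<close>

lemma length_concat_blocks: "length (concat (map (\<lambda>m. map (g m) [0..<k]) [0..<r])) = r * k"
  by (induction r) simp_all

lemma nth_concat_blocks:
  assumes "m < r" "j < k"
  shows "concat (map (\<lambda>m. map (g m) [0..<k]) [0..<r]) ! (m * k + j) = g m j"
  using assms
proof (induction r)
  case (Suc r)
  show ?case
  proof (cases "m < r")
    case True
    have "m * k + j < Suc m * k" using \<open>j < k\<close> by simp
    also have "\<dots> \<le> r * k" using True by (intro mult_le_mono1) simp
    finally show ?thesis
      using Suc.IH True \<open>j < k\<close> by (simp add: nth_append length_concat_blocks)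
  next
    case False
    then have "m = r" using Suc.prems by simp
    then show ?thesis
      using \<open>j < k\<close> by (simp add: nth_append length_concat_blocks)
  qed
qed simp

locale chart =
  fixes r d :: nat and il :: "nat list"
  assumes blocks: "length il \<le> r" and total: "sum_list il = d"
begin

text \<open>
  The number \<open>i\<^sub>m\<close>, extended by \<open>0\<close> to the blocks beyond the list: it is the exponent of \<open>y\<close> in the
  monomial whose column comes first after the columns of the identity submatrix.
\<close>

definition height :: "nat \<Rightarrow> nat" where
  "height m = (if m < length il then il ! m else 0)"

text \<open>
  The rows of the matrix: the pair \<open>(m, j)\<close> stands for the basis element \<open>x\<^sup>d\<^sup>-\<^sup>jy\<^sup>je\<^sub>m\<close>.  The same pairs
  index the monomials \<open>x\<^sup>n\<^sup>-\<^sup>jy\<^sup>je\<^sub>m\<close> of any degree \<open>n \<ge> d\<close>, which are \<open>chosen_monomials n il\<close>.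
\<close>

definition positions :: "(nat \<times> nat) list" where
  "positions = concat (map (\<lambda>m. map (Pair m) [0..<il ! m]) [0..<length il])"

lemma chosen_monomials_eq:
  "chosen_monomials n il = map (\<lambda>(m, j). monomial_vec n m j) positions"
  by (simp add: chosen_monomials_def positions_def map_concat o_def)

lemma length_positions: "length positions = d"
proof -
  have "length positions = sum_list (map ((!) il) [0..<length il])"
    by (simp add: positions_def length_concat o_def)
  then show ?thesis by (simp add: map_nth total)
qed

lemma set_positions: "set positions = {(m, j). m < r \<and> j < height m}"
  using blocks by (auto simp: positions_def height_def split: if_splits)

lemma distinct_positions: "distinct positions"
proof -
  have "distinct (concat (map (\<lambda>m. map (Pair m) [0..<il ! m]) [0..<n]))" for n
    by (induction n) (auto simp: distinct_map inj_on_def)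
  then show ?thesis by (simp add: positions_def)
qed

lemma height_le: "height m \<le> d"
  using total by (auto simp: height_def intro: member_le_sum_list)

lemma positions_nth:
  assumes "h < d"
  obtains m j where "positions ! h = (m, j)" "m < r" "j < height m" "j < d"
proof -
  have "positions ! h \<in> set positions"
    using assms by (simp add: length_positions)
  then obtain m j where "positions ! h = (m, j)" "m < r" "j < height m"
    by (auto simp: set_positions)
  moreover from this have "j < d"
    using height_le[of m] by simp
  ultimately show thesis
    by (rule that)
qed

lemma position_exists:
  assumes "m < r" "j < height m"
  obtains k where "k < d" "\<And>h. h < d \<Longrightarrow> positions ! h = (m, j) \<longleftrightarrow> h = k"
proof -
  have "(m, j) \<in> set positions"
    using assms by (simp add: set_positions)
  then obtain k where "k < d" "positions ! k = (m, j)"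
    by (auto simp: in_set_conv_nth length_positions)
  then show thesis
    by (intro that[of k]) (auto simp: distinct_positions length_positions nth_eq_iff_index_eq
        simp flip: \<open>positions ! k = (m, j)\<close>)
qed

lemma length_chosen_monomials: "length (chosen_monomials n il) = d"
  by (simp add: chosen_monomials_eq length_positions)

lemma chosen_monomials_nth:
  "h < d \<Longrightarrow> positions ! h = (m, j) \<Longrightarrow> chosen_monomials n il ! h = monomial_vec n m j"
  by (simp add: chosen_monomials_eq length_positions)

lemma chosen_monomials_in_free_module_deg:
  assumes "d \<le> n"
  shows "set (chosen_monomials n il) \<subseteq> free_module_deg r n"
proof -
  have "monomial_vec n m j \<in> free_module_deg r n" if "m < r" "j < height m" for m j
    using that height_le[of m] assms by (intro monomial_vec_in_free_module_deg) auto
  then show ?thesis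
    by (auto simp: chosen_monomials_eq set_positions)
qed

text \<open>
  The chosen monomials of degree \<open>n\<close> are \<open>x\<^sup>n\<^sup>-\<^sup>d\<close> times those of degree \<open>d\<close>, so multiplication by powers
  of \<open>x\<close> preserves coordinates.
\<close>

lemma smult_x_comb_chosen:
  fixes c :: "nat \<Rightarrow> 'a::{comm_ring,comm_monoid_mult}"
  assumes "d \<le> n"
  shows "smult_vec (xy a 0) (comb c (chosen_monomials n il)) = comb c (chosen_monomials (n + a) il)"
proof -
  have "smult_vec (xy a 0) (chosen_monomials n il ! h :: 'a bivec) = chosen_monomials (n + a) il ! h" if "h < d" for h
  proof -
    obtain m j where "positions ! h = (m, j)" "j < d"
      using positions_nth[OF \<open>h < d\<close>] by metis
    then show ?thesis
      using that assms by (simp add: chosen_monomials_nth smult_monomial_vec)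
  qed
  then show ?thesis
    unfolding smult_comb by (simp add: comb_def length_chosen_monomials)
qed

text \<open>
  The column of block \<open>m\<close> belonging to \<open>y\<^sup>j\<close> when \<open>j \<le> i\<^sub>m\<close>: a column of the identity matrix for
  \<open>j < i\<^sub>m\<close>, and the prescribed column \<open>w\<close> for \<open>j = i\<^sub>m\<close>.
\<close>

definition column :: "(nat \<times> nat \<Rightarrow> 'a) \<Rightarrow> nat \<Rightarrow> nat \<Rightarrow> nat \<Rightarrow> 'a::{comm_ring,comm_monoid_mult}" where
  "column w m j h =
     (if j < height m then (if positions ! h = (m, j) then 1 else 0) else w (h, m))"

text \<open>
  Multiplication by \<open>t = y/x\<close> on \<open>A\<^sup>d\<close>: the basis vector \<open>t\<^sup>je\<^sub>m\<close> is mapped to \<open>t\<^sup>j\<^sup>+\<^sup>1e\<^sub>m\<close>, for which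
  \<open>j + 1 \<le> i\<^sub>m\<close>.
\<close>

definition mult_y :: "(nat \<times> nat \<Rightarrow> 'a) \<Rightarrow> (nat \<Rightarrow> 'a) \<Rightarrow> nat \<Rightarrow> 'a::{comm_ring,comm_monoid_mult}" where
  "mult_y w v k = (\<Sum>h<d. v h * column w (fst (positions ! h)) (Suc (snd (positions ! h))) k)"

text \<open>
  The image of \<open>t\<^sup>je\<^sub>m\<close> in \<open>A\<^sup>d\<close>, for arbitrary \<open>j\<close>.
\<close>

definition coord :: "(nat \<times> nat \<Rightarrow> 'a) \<Rightarrow> nat \<Rightarrow> nat \<Rightarrow> nat \<Rightarrow> 'a::{comm_ring,comm_monoid_mult}" where
  "coord w m j = (mult_y w ^^ j) (column w m 0)"

text \<open>
  The image in \<open>A\<^sup>d\<close> of the homogeneous component of degree \<open>n\<close> of \<open>f\<close>, after the substitution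
  \<open>x = 1\<close>, \<open>y = t\<close>.
\<close>

definition coords :: "(nat \<times> nat \<Rightarrow> 'a) \<Rightarrow> nat \<Rightarrow> 'a bivec \<Rightarrow> nat \<Rightarrow> 'a::{comm_ring,comm_monoid_mult}" where
  "coords w n f h = (\<Sum>m<r. \<Sum>j\<le>n. Poly_Mapping.lookup (f m) (n - j, j) * coord w m j h)"

definition chart_module :: "(nat \<times> nat \<Rightarrow> 'a) \<Rightarrow> 'a::{comm_ring,comm_monoid_mult} bivec set" where
  "chart_module w = {f \<in> free_module r. \<forall>n. \<forall>h<d. coords w n f h = 0}"

lemma coord_Suc: "coord w m (Suc j) = mult_y w (coord w m j)"
  by (simp add: coord_def)

text \<open>
  As long as \<open>j < i\<^sub>m\<close>, the vector \<open>t\<^sup>je\<^sub>m\<close> is a basis vector, and \<open>mult_y\<close> picks the next column.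
\<close>

lemma coord_eq_column:
  "m < r \<Longrightarrow> j \<le> height m \<Longrightarrow> h < d \<Longrightarrow> coord w m j h = column w m j h"
proof (induction j arbitrary: h)
  case 0
  then show ?case by (simp add: coord_def)
next
  case (Suc j)
  then have j: "j < height m" by simp
  obtain k where k: "k < d" "\<And>h. h < d \<Longrightarrow> positions ! h = (m, j) \<longleftrightarrow> h = k"
    using position_exists[OF \<open>m < r\<close> j] by blast
  have "coord w m (Suc j) h =
      (\<Sum>i<d. column w m j i * column w (fst (positions ! i)) (Suc (snd (positions ! i))) h)"
    using Suc by (simp add: coord_Suc mult_y_def)
  also have "\<dots> = (\<Sum>i<d. if i = k then column w m (Suc j) h else 0)"
  proof (rule sum.cong)
    fix i assume "i \<in> {..<d}"
    then have "positions ! i = (m, j) \<longleftrightarrow> i = k" using k(2) by simp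
    then show "column w m j i * column w (fst (positions ! i)) (Suc (snd (positions ! i))) h =
        (if i = k then column w m (Suc j) h else 0)"
      using j by (cases "i = k") (simp_all add: column_def[of w m j])
  qed simp
  finally show ?case
    using k(1) by simp
qed

lemma coord_cong:
  assumes "\<And>h m. h < d \<Longrightarrow> m < r \<Longrightarrow> w (h, m) = w' (h, m)"
  shows "m < r \<Longrightarrow> h < d \<Longrightarrow> coord w m j h = coord w' m j h"
proof (induction j arbitrary: h)
  case 0
  then show ?case by (simp add: coord_def column_def assms)
next
  case (Suc j)
  have "column w (fst (positions ! i)) k h = column w' (fst (positions ! i)) k h" if "i < d" for i k
    using positions_nth[OF that] Suc.prems by (fastforce simp: column_def assms)
  then show ?case
    using Suc by (simp add: coord_Suc mult_y_def)
qed

lemma chart_module_cong: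
  assumes "\<And>h m. h < d \<Longrightarrow> m < r \<Longrightarrow> w (h, m) = w' (h, m)"
  shows "chart_module w = chart_module w'"
proof -
  have "coords w n f h = coords w' n f h" if "h < d" for n f h
    using that by (simp add: coords_def coord_cong[of w w'] assms)
  then show ?thesis by (auto simp: chart_module_def)
qed

lemma coords_zero: "coords w n (\<lambda>m. 0) h = 0"
  by (simp add: coords_def)

lemma coords_add: "coords w n (\<lambda>m. f m + g m) h = coords w n f h + coords w n g h"
  by (simp add: coords_def lookup_add distrib_right sum.distrib)

lemma coords_diff: "coords w n (\<lambda>m. f m - g m) h = coords w n f h - coords w n g h"
  by (simp add: coords_def lookup_minus left_diff_distrib sum_subtractf)

lemma coords_const: "coords w n (\<lambda>m. const c * f m) h = c * coords w n f h"
  by (simp add: coords_def lookup_const_mult sum_distrib_left mult.assoc)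

lemma coords_sum: "coords w n (\<lambda>m. \<Sum>i\<in>I. g i m) h = (\<Sum>i\<in>I. coords w n (g i) h)"
  by (induction I rule: infinite_finite_induct) (simp_all add: coords_zero coords_add)

lemma coords_monomial:
  assumes "m < r" "j \<le> n"
  shows "coords w n (monomial_vec n m j) h = coord w m j h"
proof -
  have "coords w n (monomial_vec n m j) h =
      (\<Sum>m'<r. if m' = m then \<Sum>j'\<le>n. if j' = j then coord w m j h else 0 else 0)"
    unfolding coords_def
  proof (intro sum.cong refl)
    fix m'
    have "Poly_Mapping.lookup (monomial_vec n m j m') (n - j', j') * coord w m' j' h =
        (if m' = m then if j' = j then coord w m j h else 0 else 0)" for j'
      by (auto simp: monomial_vec_def lookup_single when_def)
    then show "(\<Sum>j'\<le>n. Poly_Mapping.lookup (monomial_vec n m j m') (n - j', j') * coord w m' j' h) =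
        (if m' = m then \<Sum>j'\<le>n. if j' = j then coord w m j h else 0 else 0)"
      by simp
  qed
  then show ?thesis
    using assms by simp
qed

lemma coords_other_degree:
  assumes "f \<in> free_module_deg r n" "k \<noteq> n"
  shows "coords w k f h = 0"
proof -
  have "Poly_Mapping.lookup (f m) (k - j, j) = 0" if "j \<le> k" for m j
    using assms that by (auto simp: free_module_deg_iff)
  then show ?thesis by (simp add: coords_def)
qed

lemma coords_hom_component:
  "coords w k (hom_component n f) h = (if k = n then coords w n f h else 0)"
  by (simp add: coords_def lookup_hom_component)

lemma coords_x_0: "coords w 0 (smult_vec (xy 1 0) f) h = 0"
  by (simp add: coords_def smult_vec_def lookup_monomial_mult)

lemma coords_x_Suc: "coords w (Suc n) (smult_vec (xy 1 0) f) h = coords w n f h"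
proof -
  have "(\<Sum>j\<le>Suc n. Poly_Mapping.lookup (smult_vec (xy 1 0) f m) (Suc n - j, j) * coord w m j h) =
      (\<Sum>j\<le>n. Poly_Mapping.lookup (f m) (n - j, j) * coord w m j h)" for m
    by (simp add: smult_vec_def lookup_monomial_mult Suc_diff_le)
  then show ?thesis by (simp add: coords_def)
qed

lemma coords_y_0: "coords w 0 (smult_vec (xy 0 1) f) h = 0"
  by (simp add: coords_def smult_vec_def lookup_monomial_mult)

lemma coords_y_Suc: "coords w (Suc n) (smult_vec (xy 0 1) f) h = mult_y w (coords w n f) h"
proof -
  let ?c = "\<lambda>h'. column w (fst (positions ! h')) (Suc (snd (positions ! h'))) h"
  have "coords w (Suc n) (smult_vec (xy 0 1) f) h =
      (\<Sum>m<r. \<Sum>j\<le>n. Poly_Mapping.lookup (f m) (n - j, j) * coord w m (Suc j) h)"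
    unfolding coords_def smult_vec_def lookup_monomial_mult sum.atMost_Suc_shift
    by (intro sum.cong refl) simp
  also have "\<dots> = (\<Sum>m<r. \<Sum>j\<le>n. \<Sum>i<d. Poly_Mapping.lookup (f m) (n - j, j) * coord w m j i * ?c i)"
    by (simp add: coord_Suc mult_y_def sum_distrib_left mult.assoc)
  also have "\<dots> = (\<Sum>m<r. \<Sum>i<d. \<Sum>j\<le>n. Poly_Mapping.lookup (f m) (n - j, j) * coord w m j i * ?c i)"
    by (intro sum.cong refl sum.swap)
  also have "\<dots> = (\<Sum>i<d. \<Sum>m<r. \<Sum>j\<le>n. Poly_Mapping.lookup (f m) (n - j, j) * coord w m j i * ?c i)"
    by (rule sum.swap)
  also have "\<dots> = mult_y w (coords w n f) h"
    by (simp add: mult_y_def coords_def sum_distrib_right)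
  finally show ?thesis .
qed

lemma chart_module_x: "f \<in> chart_module w \<Longrightarrow> smult_vec (xy 1 0) f \<in> chart_module w"
  unfolding chart_module_def
  by (auto simp: smult_mem_free_module) (metis coords_x_0 coords_x_Suc not0_implies_Suc One_nat_def)

lemma chart_module_y:
  assumes "f \<in> chart_module w"
  shows "smult_vec (xy 0 1) f \<in> chart_module w"
proof -
  have "coords w n (smult_vec (xy 0 1) f) h = 0" if "h < d" for n h
  proof (cases n)
    case (Suc k)
    have "mult_y w (coords w k f) h = 0"
      unfolding mult_y_def by (rule sum.neutral) (use assms in \<open>auto simp: chart_module_def\<close>)
    then show ?thesis by (simp only: Suc coords_y_Suc)
  qed (use coords_y_0 in simp)
  then show ?thesis
    using assms by (simp add: chart_module_def smult_mem_free_module)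
qed

lemma chart_module_add:
  "f \<in> chart_module w \<Longrightarrow> g \<in> chart_module w \<Longrightarrow> (\<lambda>m. f m + g m) \<in> chart_module w"
  by (auto simp: chart_module_def coords_add free_module_def)

text \<open>
  The monomials are products of \<open>x\<close> and \<open>y\<close>, under which \<open>coords\<close> changes by the identity and by the
  endomorphism \<open>mult_y\<close>.
\<close>

lemma chart_module_monomial:
  assumes "f \<in> chart_module w"
  shows "smult_vec (Poly_Mapping.single (a, b) c) f \<in> chart_module w"
proof (induction a)
  case 0
  show ?case
  proof (induction b)
    case 0
    show ?case
      using assms by (auto simp: chart_module_def smult_vec_def coords_const free_module_def)
  next
    case (Suc b)
    have "smult_vec (Poly_Mapping.single (0, Suc b) c) f =
        smult_vec (xy 0 1) (smult_vec (Poly_Mapping.single (0, b) c) f)"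
      by (simp add: smult_vec_def mult_single flip: mult.assoc)
    then show ?case using chart_module_y[OF Suc] by (simp only:)
  qed
next
  case (Suc a)
  have "smult_vec (Poly_Mapping.single (Suc a, b) c) f =
      smult_vec (xy 1 0) (smult_vec (Poly_Mapping.single (a, b) c) f)"
    by (simp add: smult_vec_def mult_single flip: mult.assoc)
  then show ?case using chart_module_x[OF Suc] by (simp only:)
qed

lemma chart_module_smult:
  assumes "f \<in> chart_module w"
  shows "smult_vec p f \<in> chart_module w"
proof -
  have "(\<lambda>m. \<Sum>k\<in>K. Poly_Mapping.single k (Poly_Mapping.lookup p k) * f m) \<in> chart_module w"
    if "finite K" for K
    using that
  proof (induction K)
    case empty
    show ?case by (simp add: chart_module_def coords_zero free_module_def)
  next
    case (insert k K)
    moreover have "(\<lambda>m. Poly_Mapping.single k (Poly_Mapping.lookup p k) * f m) \<in> chart_module w"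
      using chart_module_monomial[OF assms, of "fst k" "snd k"] by (simp add: smult_vec_def)
    ultimately show ?case by (simp add: chart_module_add)
  qed
  moreover have "smult_vec p f =
      (\<lambda>m. \<Sum>k\<in>Poly_Mapping.keys p. Poly_Mapping.single k (Poly_Mapping.lookup p k) * f m)"
    by (subst poly_mapping_as_sum_of_monomials[of p]) (simp only: smult_vec_def sum_distrib_right)
  ultimately show ?thesis by simp
qed

lemma submodule_chart_module: "is_submodule r (chart_module w)"
  unfolding is_submodule_def
  by (auto simp: chart_module_add chart_module_smult)
     (auto simp: chart_module_def coords_zero free_module_def)

lemma graded_chart_module: "is_graded_submodule r (chart_module w)"
  unfolding is_graded_submodule_def
proof (intro conjI ballI allI submodule_chart_module)
  fix f n
  assume "f \<in> chart_module w"
  then show "hom_component n f \<in> chart_module w"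
    using hom_component_in_free_module_deg[of f r n]
    by (auto simp: chart_module_def coords_hom_component free_module_deg_iff)
qed

lemma coords_x_power: "coords w (n + a) (smult_vec (xy a 0) f) h = coords w n f h"
proof (induction a)
  case 0
  then show ?case by (simp add: smult_vec_def const_one_mult)
next
  case (Suc a)
  have "smult_vec (xy (Suc a) 0) f = smult_vec (xy 1 0) (smult_vec (xy a 0) f)"
    by (simp add: smult_vec_def mult_single flip: mult.assoc)
  then show ?case using Suc coords_x_Suc[of w "n + a"] by simp
qed

text \<open>
  Multiplication by a power of \<open>x\<close> alone does not change the image in \<open>A\<^sup>d\<close>.
\<close>

lemma saturated_chart_module: "is_saturated r (chart_module w)"
  unfolding is_saturated_def
proof
  fix f
  assume "f \<in> saturation r (chart_module w)"
  then obtain N where f: "f \<in> free_module r" "smult_vec (xy N 0) f \<in> chart_module w"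
    unfolding saturation_def by force
  have "coords w n f h = 0" if "h < d" for n h
  proof -
    have "coords w (n + N) (smult_vec (xy N 0) f) h = 0"
      using f(2) that by (simp add: chart_module_def)
    then show ?thesis by (simp add: coords_x_power)
  qed
  then show "f \<in> chart_module w"
    using f(1) by (simp add: chart_module_def)
qed

lemma coords_chosen_monomials:
  assumes "d \<le> n" "k < d" "h < d"
  shows "coords w n (chosen_monomials n il ! k) h = (if h = k then 1 else 0)"
proof -
  obtain m j where mj: "positions ! k = (m, j)" "m < r" "j < height m" "j < d"
    using positions_nth[OF \<open>k < d\<close>] by metis
  then have "coords w n (chosen_monomials n il ! k) h = column w m j h"
    using assms by (simp add: chosen_monomials_nth coords_monomial coord_eq_column)
  also have "\<dots> = (if h = k then 1 else 0)"
    using mj assms by (auto simp: column_def distinct_positions length_positions nth_eq_iff_index_eq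
        simp flip: mj(1))
  finally show ?thesis .
qed

lemma coords_comb_chosen:
  assumes "d \<le> n" "h < d"
  shows "coords w n (comb c (chosen_monomials n il)) h = c h"
proof -
  have "coords w n (comb c (chosen_monomials n il)) h = (\<Sum>k<d. if k = h then c h else 0)"
    unfolding comb_def coords_sum length_chosen_monomials coords_const
    using assms by (intro sum.cong) (auto simp: coords_chosen_monomials)
  then show ?thesis using assms by simp
qed

lemma comb_chosen_in_free_module_deg:
  fixes c :: "nat \<Rightarrow> 'a::{comm_ring,comm_monoid_mult}"
  assumes "d \<le> n"
  shows "comb c (chosen_monomials n il) \<in> free_module_deg r n"
proof -
  have "(chosen_monomials n il ! h :: 'a bivec) \<in> free_module_deg r n" if "h < d" for h
    using chosen_monomials_in_free_module_deg[OF assms] that length_chosen_monomials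
    by (metis nth_mem subsetD)
  then show ?thesis
    by (simp add: free_module_deg_iff free_module_def comb_def lookup_sum lookup_const_mult
        length_chosen_monomials)
qed

lemma chart_module_congruence:
  assumes "d \<le> n" "f \<in> free_module_deg r n"
  shows "congruent_mod (chart_module w) f (comb (coords w n f) (chosen_monomials n il))"
proof -
  let ?g = "comb (coords w n f) (chosen_monomials n il)"
  have g: "?g \<in> free_module_deg r n"
    by (rule comb_chosen_in_free_module_deg[OF assms(1)])
  have "coords w k (\<lambda>m. f m - ?g m) h = 0" if "h < d" for k h
  proof (cases "k = n")
    case True
    then show ?thesis
      using assms that by (simp add: coords_diff coords_comb_chosen)
  next
    case False
    then show ?thesis
      using assms g by (simp add: coords_diff coords_other_degree)
  qed
  moreover have "(\<lambda>m. f m - ?g m) \<in> free_module r"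
    using assms g by (auto simp: free_module_deg_iff free_module_def)
  ultimately show ?thesis
    by (simp add: congruent_mod_def chart_module_def)
qed

text \<open>
  The homomorphism to \<open>A\<^sup>d\<close> maps the chosen monomials of degree \<open>n\<close> to the unit vectors, so it
  identifies the component of degree \<open>n\<close> of the quotient with \<open>A\<^sup>d\<close>.
\<close>

lemma chart_module_basis:
  assumes "d \<le> n"
  shows "is_quotient_basis (free_module_deg r n) (chart_module w) (chosen_monomials n il)"
  unfolding is_quotient_basis_iff
proof (intro conjI ballI allI impI)
  show "set (chosen_monomials n il) \<subseteq> free_module_deg r n"
    by (rule chosen_monomials_in_free_module_deg[OF assms])
  show "\<exists>c. congruent_mod (chart_module w) f (comb c (chosen_monomials n il))"
    if "f \<in> free_module_deg r n" for f
    using chart_module_congruence[OF assms that] by blast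
  show "c h = 0" if "comb c (chosen_monomials n il) \<in> chart_module w"
    and "h < length (chosen_monomials n il)" for c h
    using that coords_comb_chosen[OF assms, of h w c]
    by (simp add: chart_module_def length_chosen_monomials)
qed

lemma chart_module_in_Q_points: "chart_module w \<in> Q_points r d il"
  unfolding Q_points_def Quot_points_def
  using graded_chart_module[of w] saturated_chart_module[of w] chart_module_basis[of _ w]
    is_quotient_basis_locally_free[OF chart_module_basis[of _ w]]
  by (simp add: length_chosen_monomials)

lemma C_matrix_first_free_column:
  fixes V :: "'a::{comm_ring,comm_monoid_mult} bivec set"
  assumes "h < d" "m < r"
  shows "C_matrix r d il V $$ (h, first_free_column d il m) =
    quotient_coords V (chosen_monomials d il) (monomial_vec d m (height m)) $ h"
proof -
  define q where "q = first_free_column d il m"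
  have q: "q = m * (d + 1) + height m"
    by (simp add: q_def first_free_column_def height_def)
  have "q < Suc m * (d + 1)"
    using height_le[of m] by (simp add: q)
  also have "\<dots> \<le> r * (d + 1)"
    using assms by (intro mult_le_mono1) simp
  finally have "q < length (all_monomials r d :: 'a bivec list)"
    unfolding all_monomials_def length_concat_blocks .
  moreover have "all_monomials r d ! q = (monomial_vec d m (height m) :: 'a bivec)"
    unfolding all_monomials_def q using assms height_le[of m] by (intro nth_concat_blocks) auto
  ultimately show ?thesis
    using assms by (simp add: C_matrix_def mat_of_cols_def flip: q_def)
qed

text \<open>
  The values of the variables \<open>w\<^sub>h\<^sub>,\<^sub>m\<close> at the point \<open>V\<close>.
\<close>

definition chart_coords :: "'a::{comm_ring,comm_monoid_mult} bivec set \<Rightarrow> nat \<times> nat \<Rightarrow> 'a" where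
  "chart_coords V = (\<lambda>(h, m). C_matrix r d il V $$ (h, first_free_column d il m))"

lemma chart_coords_chart_module:
  assumes "h < d" "m < r"
  shows "chart_coords (chart_module w) (h, m) = w (h, m)"
proof -
  interpret submodule_of_free r "chart_module w"
    by unfold_locales (rule submodule_chart_module)
  have "monomial_vec d m (height m) \<in> free_module_deg r d"
    using assms height_le by (intro monomial_vec_in_free_module_deg)
  from quotient_coords_eq[OF chart_module_basis[OF order_refl] chart_module_congruence[OF order_refl this], of h]
  have "chart_coords (chart_module w) (h, m) = coords w d (monomial_vec d m (height m)) h"
    unfolding chart_coords_def
    using assms by (simp add: C_matrix_first_free_column length_chosen_monomials)
  also have "\<dots> = w (h, m)"
    using assms height_le by (simp add: coords_monomial coord_eq_column column_def)
  finally show ?thesis .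
qed

end

section \<open>A point of the chart is determined by its columns\<close>

text \<open>
  The next two lemmas apply both to the points of the chart and to the submodules over \<open>B\<close> that contain the
  image of such a point under a homomorphism \<open>A \<rightarrow> B\<close>.
\<close>

locale chart_submodule = chart r d il + submodule_of_free r V
  for r d :: nat and il :: "nat list" and V :: "'a::{comm_ring,comm_monoid_mult} bivec set"
begin

lemma homogeneous_congruence:
  assumes f: "f \<in> free_module_deg r n"
    and monomials: "\<And>m j. m < r \<Longrightarrow> j \<le> n \<Longrightarrow>
      congruent_mod V (monomial_vec n m j) (comb (t m j) (chosen_monomials n il))"
  shows "congruent_mod V f
    (comb (\<lambda>h. \<Sum>m<r. \<Sum>j\<le>n. Poly_Mapping.lookup (f m) (n - j, j) * t m j h) (chosen_monomials n il))"
proof -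
  have "congruent_mod V
      (\<lambda>m'. \<Sum>m<r. const 1 * (\<Sum>j\<le>n. const (Poly_Mapping.lookup (f m) (n - j, j)) * monomial_vec n m j m'))
      (comb (\<lambda>h. \<Sum>m<r. 1 * (\<Sum>j\<le>n. Poly_Mapping.lookup (f m) (n - j, j) * t m j h)) (chosen_monomials n il))"
    by (intro cong_weighted_sum) (simp add: monomials)
  then show ?thesis
    by (subst homogeneous_expansion[OF f]) (simp add: const_one_mult)
qed

lemma homogeneous_congruence_coords:
  assumes "f \<in> free_module_deg r n"
    and "\<And>m j. m < r \<Longrightarrow> j \<le> n \<Longrightarrow>
      congruent_mod V (monomial_vec n m j) (comb (coord w m j) (chosen_monomials n il))"
  shows "congruent_mod V f (comb (coords w n f) (chosen_monomials n il))"
  using homogeneous_congruence[OF assms] by (simp add: coords_def[abs_def])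

end

locale Q_point = chart r d il for r d il +
  fixes V :: "'a::{comm_ring,comm_monoid_mult} bivec set"
  assumes Q: "V \<in> Q_points r d il"

sublocale Q_point \<subseteq> chart_submodule r d il V
  using Q by unfold_locales (auto simp: Q_points_def Quot_points_def is_graded_submodule_def)

context Q_point
begin

lemma Q_graded: "f \<in> V \<Longrightarrow> hom_component n f \<in> V"
  and Q_saturated: "saturation r V \<subseteq> V"
  and Q_locally_free: "d \<le> n \<Longrightarrow> locally_free_quotient d (free_module_deg r n) V"
  and Q_basis: "is_quotient_basis (free_module_deg r d) V (chosen_monomials d il)"
  using Q by (auto simp: Q_points_def Quot_points_def is_graded_submodule_def is_saturated_def)

text \<open>
  Induction on \<open>n\<close>.  A monomial of degree \<open>n + 1\<close> divisible by \<open>x\<close> is \<open>x\<close> times a combination of the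
  chosen monomials of degree \<open>n\<close>.  The only other monomials are \<open>y\<^sup>n\<^sup>+\<^sup>1e\<^sub>m\<close>.  Each is \<open>y\<close> times a
  combination of the chosen monomials of degree \<open>n\<close>, whose exponents of \<open>y\<close> are less than \<open>d \<le> n\<close>; so
  after the multiplication by \<open>y\<close> they are still divisible by \<open>x\<close>, and the first case applies.
\<close>

lemma generators_in_degree:
  assumes "d \<le> n"
  shows "f \<in> free_module_deg r n \<Longrightarrow> \<exists>c. congruent_mod V f (comb c (chosen_monomials n il))"
  using assms
proof (induction n arbitrary: f rule: dec_induct)
  case base
  then show ?case using Q_basis by (simp add: is_quotient_basis_iff)
next
  case (step n)
  have low: "\<exists>c. congruent_mod V (monomial_vec (Suc n) m j) (comb c (chosen_monomials (Suc n) il))"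
    if "m < r" "j \<le> n" for m j
  proof -
    obtain c where "congruent_mod V (monomial_vec n m j) (comb c (chosen_monomials n il))"
      using step.IH[OF monomial_vec_in_free_module_deg[OF \<open>m < r\<close> \<open>j \<le> n\<close>]] by blast
    from cong_smult[OF this, of "xy 1 0"] show ?thesis
      using that step.hyps by (auto simp: smult_x_comb_chosen smult_monomial_vec)
  qed
  have high: "\<exists>c. congruent_mod V (monomial_vec (Suc n) m (Suc n)) (comb c (chosen_monomials (Suc n) il))"
    if "m < r" for m
  proof -
    obtain c where c: "congruent_mod V (monomial_vec n m n) (comb c (chosen_monomials n il))"
      using step.IH[OF monomial_vec_in_free_module_deg[OF \<open>m < r\<close> order_refl]] by blast
    have "\<exists>t. congruent_mod V (smult_vec (xy 0 1) (chosen_monomials n il ! h)) (comb t (chosen_monomials (Suc n) il))"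
      if "h < d" for h
    proof -
      obtain m' j where mj: "positions ! h = (m', j)" "m' < r" "j < d"
        using positions_nth[OF \<open>h < d\<close>] by metis
      then have "smult_vec (xy 0 1) (chosen_monomials n il ! h) = (monomial_vec (Suc n) m' (Suc j) :: 'a bivec)"
        using \<open>h < d\<close> step.hyps by (simp add: chosen_monomials_nth smult_monomial_vec)
      then show ?thesis
        using low[OF mj(2), of "Suc j"] mj(3) step.hyps by simp
    qed
    then obtain t where t: "\<And>h. h < d \<Longrightarrow> congruent_mod V (smult_vec (xy 0 1) (chosen_monomials n il ! h))
        (comb (t h) (chosen_monomials (Suc n) il))"
      by metis
    have "(monomial_vec (Suc n) m (Suc n) :: 'a bivec) = smult_vec (xy 0 1) (monomial_vec n m n)"
      by (simp add: smult_monomial_vec)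
    with cong_smult[OF c, of "xy 0 1"]
    have "congruent_mod V (monomial_vec (Suc n) m (Suc n))
        (\<lambda>m. \<Sum>h<d. const (c h) * smult_vec (xy 0 1) (chosen_monomials n il ! h) m)"
      by (simp only: smult_comb length_chosen_monomials)
    also have "congruent_mod V \<dots> (comb (\<lambda>k. \<Sum>h<d. c h * t h k) (chosen_monomials (Suc n) il))"
      by (intro cong_weighted_sum t) simp
    finally show ?thesis by blast
  qed
  have "\<exists>c. congruent_mod V (monomial_vec (Suc n) m j) (comb c (chosen_monomials (Suc n) il))"
    if "m < r" "j \<le> Suc n" for m j
    using that low high by (cases "j = Suc n") auto
  then obtain t where "\<And>m j. m < r \<Longrightarrow> j \<le> Suc n \<Longrightarrow>
      congruent_mod V (monomial_vec (Suc n) m j) (comb (t m j) (chosen_monomials (Suc n) il))"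
    by metis
  from homogeneous_congruence[OF step.prems this] show ?case by blast
qed

lemma basis_in_degree:
  assumes "d \<le> n"
  shows "is_quotient_basis (free_module_deg r n) V (chosen_monomials n il)"
  using generators_in_degree[OF assms]
  by (intro generators_are_basis[OF Q_locally_free[OF assms]])
    (simp_all add: length_chosen_monomials chosen_monomials_in_free_module_deg assms)

lemma comb_eq_zero:
  assumes "d \<le> n" "comb c (chosen_monomials n il) \<in> V" "h < d"
  shows "c h = 0"
  using basis_in_degree[OF assms(1)] assms(2,3)
  by (simp add: is_quotient_basis_iff length_chosen_monomials)

text \<open>
  Multiplication by \<open>x\<close> sends a basis of the degree \<open>n\<close> component to a basis of the next one, so it is
  injective.
\<close>

lemma cancel_x:
  assumes "d \<le> n" "f \<in> free_module_deg r n"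
    and "congruent_mod V (smult_vec (xy 1 0) f) (comb c (chosen_monomials (Suc n) il))"
  shows "congruent_mod V f (comb c (chosen_monomials n il))"
proof -
  obtain c' where c': "congruent_mod V f (comb c' (chosen_monomials n il))"
    using generators_in_degree[OF assms(1,2)] by blast
  from cong_smult[OF this, of "xy 1 0"]
  have "congruent_mod V (smult_vec (xy 1 0) f) (comb c' (chosen_monomials (Suc n) il))"
    by (simp add: smult_x_comb_chosen assms(1))
  with assms(3) have "congruent_mod V (comb c' (chosen_monomials (Suc n) il)) (comb c (chosen_monomials (Suc n) il))"
    using cong_sym cong_trans by blast
  then have "comb (\<lambda>h. c' h - c h) (chosen_monomials (Suc n) il) \<in> V"
    by (simp add: congruent_mod_def comb_diff)
  from comb_eq_zero[OF _ this] have "c' h = c h" if "h < d" for h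
    using that assms(1) by simp
  then have "comb c' (chosen_monomials n il) = comb c (chosen_monomials n il)"
    by (intro comb_cong) (simp add: length_chosen_monomials)
  with c' show ?thesis by simp
qed

abbreviation (input) w where "w \<equiv> chart_coords V"

text \<open>
  The columns of the matrix up to the first one outside the identity submatrix, carried from degree
  \<open>d\<close> to degree \<open>n\<close> by a power of \<open>x\<close>.
\<close>

lemma column_congruence:
  assumes "m < r" "j \<le> height m" "d \<le> n"
  shows "congruent_mod V (monomial_vec n m j) (comb (column w m j) (chosen_monomials n il))"
proof -
  have j: "j \<le> d" using assms(2) height_le[of m] by simp
  have "congruent_mod V (monomial_vec d m j) (comb (column w m j) (chosen_monomials d il))"
  proof (cases "j < height m")
    case True
    obtain k where k: "k < d" "\<And>h. h < d \<Longrightarrow> positions ! h = (m, j) \<longleftrightarrow> h = k"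
      using position_exists[OF \<open>m < r\<close> True] by blast
    have "comb (column w m j) (chosen_monomials d il) =
        comb (\<lambda>h. if h = k then 1 else 0) (chosen_monomials d il)"
      using True k(2) by (intro comb_cong) (simp add: column_def length_chosen_monomials)
    also have "\<dots> = chosen_monomials d il ! k"
      using k(1) by (simp add: comb_unit length_chosen_monomials)
    also have "\<dots> = monomial_vec d m j"
      using k by (simp add: chosen_monomials_nth)
    finally show ?thesis by (simp add: cong_refl)
  next
    case False
    then have "j = height m" using assms(2) by simp
    obtain c where c: "congruent_mod V (monomial_vec d m j) (comb c (chosen_monomials d il))"
      using generators_in_degree[OF order_refl monomial_vec_in_free_module_deg[OF \<open>m < r\<close> j]] by blast
    have "comb (column w m j) (chosen_monomials d il) = comb c (chosen_monomials d il)"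
    proof (rule comb_cong)
      fix h assume "h < length (chosen_monomials d il :: 'a bivec list)"
      then have "h < d" by (simp add: length_chosen_monomials)
      then show "column w m j h = c h"
        using quotient_coords_eq[OF Q_basis c, of h] \<open>j = height m\<close> \<open>m < r\<close>
        by (simp add: column_def chart_coords_def C_matrix_first_free_column length_chosen_monomials)
    qed
    with c show ?thesis by simp
  qed
  from cong_smult[OF this, of "xy (n - d) 0"] show ?thesis
    using j assms(3) by (simp add: smult_x_comb_chosen smult_monomial_vec)
qed

text \<open>
  The matrix shows how multiplication by \<open>y\<close> acts on the chosen monomials (\<open>column_congruence\<close>), so
  the coordinates of \<open>t\<^sup>j\<^sup>+\<^sup>1e\<^sub>m\<close> follow from those of \<open>t\<^sup>je\<^sub>m\<close>.
\<close>

lemma coord_congruence: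
  assumes "m < r" "j \<le> n" "d \<le> n"
  shows "congruent_mod V (monomial_vec n m j) (comb (coord w m j) (chosen_monomials n il))"
  using assms(2,3)
proof (induction j arbitrary: n)
  case 0
  then show ?case
    using column_congruence[OF \<open>m < r\<close>, of 0 n] by (simp add: coord_def)
next
  case (Suc j)
  have up: "congruent_mod V (monomial_vec (Suc k) m (Suc j)) (comb (coord w m (Suc j)) (chosen_monomials (Suc k) il))"
    if "j \<le> k" "d \<le> k" for k
  proof -
    have mult_y: "congruent_mod V (smult_vec (xy 0 1) (chosen_monomials k il ! h))
        (comb (column w (fst (positions ! h)) (Suc (snd (positions ! h)))) (chosen_monomials (Suc k) il))"
      if "h < d" for h
    proof -
      obtain m' j' where mj: "positions ! h = (m', j')" "m' < r" "j' < height m'" "j' < d"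
        using positions_nth[OF \<open>h < d\<close>] by metis
      then have "smult_vec (xy 0 1) (chosen_monomials k il ! h) = (monomial_vec (Suc k) m' (Suc j') :: 'a bivec)"
        using \<open>h < d\<close> \<open>d \<le> k\<close> by (simp add: chosen_monomials_nth smult_monomial_vec)
      then show ?thesis
        using column_congruence[OF mj(2), of "Suc j'" "Suc k"] mj \<open>d \<le> k\<close> by simp
    qed
    have "(monomial_vec (Suc k) m (Suc j) :: 'a bivec) = smult_vec (xy 0 1) (monomial_vec k m j)"
      using \<open>j \<le> k\<close> by (simp add: smult_monomial_vec)
    with cong_smult[OF Suc.IH[OF that], of "xy 0 1"]
    have "congruent_mod V (monomial_vec (Suc k) m (Suc j))
        (\<lambda>m'. \<Sum>h<d. const (coord w m j h) * smult_vec (xy 0 1) (chosen_monomials k il ! h) m')"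
      by (simp only: smult_comb length_chosen_monomials)
    also have "congruent_mod V \<dots> (comb (coord w m (Suc j)) (chosen_monomials (Suc k) il))"
      unfolding coord_Suc mult_y_def[abs_def] by (intro cong_weighted_sum mult_y) simp
    finally show ?thesis .
  qed
  \<comment> \<open>Multiplication by \<open>y\<close> raises the degree, and the induction hypothesis starts in degree \<open>d\<close>.  For the
      degree \<open>n = d\<close> itself, the congruence holds in degree \<open>d + 1\<close>, and there \<open>x\<close> can be cancelled.\<close>
  show ?case
  proof (cases "d < n")
    case True
    then show ?thesis using up[of "n - 1"] Suc.prems by simp
  next
    case False
    then have "n = d" using Suc.prems by simp
    have "congruent_mod V (smult_vec (xy 1 0) (monomial_vec d m (Suc j)))
        (comb (coord w m (Suc j)) (chosen_monomials (Suc d) il))"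
      using up[of d] Suc.prems \<open>n = d\<close> by (simp add: smult_monomial_vec)
    then show ?thesis
      using cancel_x[OF order_refl monomial_vec_in_free_module_deg[OF \<open>m < r\<close>]] Suc.prems \<open>n = d\<close>
      by simp
  qed
qed

lemma homogeneous_mem_iff:
  assumes "d \<le> n" "f \<in> free_module_deg r n"
  shows "f \<in> V \<longleftrightarrow> (\<forall>h<d. coords w n f h = 0)"
proof -
  have "f \<in> V \<longleftrightarrow> comb (coords w n f) (chosen_monomials n il) \<in> V"
    by (intro cong_mem_iff homogeneous_congruence_coords coord_congruence assms)
  moreover have "comb (coords w n f) (chosen_monomials n il) = (\<lambda>m. 0)" if "\<forall>h<d. coords w n f h = 0"
    using that by (simp add: comb_def length_chosen_monomials)
  ultimately show ?thesis
    using comb_eq_zero[OF assms(1)] zero_mem by metis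
qed

text \<open>
  Both sides agree in degrees \<open>\<ge> d\<close> (\<open>homogeneous_mem_iff\<close>).  They agree in lower degrees because
  both are saturated: multiplication by all monomials of degree \<open>d\<close> reaches the degrees \<open>\<ge> d\<close>.
\<close>

lemma V_eq_chart_module: "V = chart_module w"
proof
  show "V \<subseteq> chart_module w"
  proof
    fix f assume "f \<in> V"
    then have f: "f \<in> free_module r"
      using submodule by (auto simp: is_submodule_def)
    have "coords w n f h = 0" if "h < d" for n h
    proof -
      let ?g = "smult_vec (xy d 0) (hom_component n f)"
      have "?g \<in> V"
        using Q_graded smult_mem \<open>f \<in> V\<close> by blast
      moreover have "?g \<in> free_module_deg r (n + d)"
        using smult_xy_in_free_module_deg[OF hom_component_in_free_module_deg[OF f], of d 0] by simp
      ultimately have "coords w (n + d) ?g h = 0"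
        using homogeneous_mem_iff[of "n + d" ?g] that by simp
      then show ?thesis
        by (simp add: coords_x_power coords_hom_component)
    qed
    then show "f \<in> chart_module w"
      using f by (simp add: chart_module_def)
  qed
  show "chart_module w \<subseteq> V"
  proof
    fix f assume f: "f \<in> chart_module w"
    then have free: "f \<in> free_module r"
      by (simp add: chart_module_def)
    have comp: "hom_component n f \<in> V" for n
    proof -
      have "smult_vec (xy a b) (hom_component n f) \<in> V" if "a + b = d" for a b
      proof -
        have deg: "smult_vec (xy a b) (hom_component n f) \<in> free_module_deg r (n + d)"
          using smult_xy_in_free_module_deg[OF hom_component_in_free_module_deg[OF free], of a b] that
          by (simp add: add.assoc)
        have "smult_vec (xy a b) (hom_component n f) \<in> chart_module w"
          using graded_chart_module[of w] f
          by (intro chart_module_smult) (auto simp: is_graded_submodule_def)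
        then show ?thesis
          using homogeneous_mem_iff[OF _ deg] by (simp add: chart_module_def)
      qed
      then have "hom_component n f \<in> saturation r V"
        using hom_component_in_free_module_deg[OF free]
        by (auto simp: saturation_def free_module_deg_iff)
      then show ?thesis using Q_saturated by blast
    qed
    obtain D where "f = (\<lambda>m. \<Sum>n<D. hom_component n f m)"
      using hom_component_expansion[OF free] by blast
    with sum_mem[of "{..<D}" "\<lambda>n. hom_component n f"] comp show "f \<in> V" by simp
  qed
qed

end

section \<open>Base change\<close>

lemma saturation_mono:
  assumes "V \<subseteq> W"
  shows "saturation r V \<subseteq> saturation r W"
proof
  fix f
  assume "f \<in> saturation r V"
  then obtain N where "f \<in> free_module r" "\<And>a b. a + b = N \<Longrightarrow> smult_vec (xy a b) f \<in> V"
    unfolding saturation_def by blast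
  then show "f \<in> saturation r W"
    using assms unfolding saturation_def by blast
qed

lemma unital_ring_hom_simps:
  assumes "unital_ring_hom f"
  shows "f 1 = 1" "f (a + b) = f a + f b" "f (a * b) = f a * f b" "f 0 = 0"
proof -
  show "f 1 = 1" "f (a + b) = f a + f b" "f (a * b) = f a * f b"
    using assms by (auto simp: unital_ring_hom_def)
  have "f (0 + 0) = f 0 + f 0"
    using assms unfolding unital_ring_hom_def by blast
  then show "f 0 = 0" by simp
qed

lemma unital_ring_hom_sum:
  assumes "unital_ring_hom f"
  shows "f (\<Sum>i\<in>I. g i) = (\<Sum>i\<in>I. f (g i))"
  by (induction I rule: infinite_finite_induct) (simp_all add: unital_ring_hom_simps[OF assms])

lemma unital_ring_hom_prod:
  assumes "unital_ring_hom f"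
  shows "f (\<Prod>i\<in>I. g i) = (\<Prod>i\<in>I. f (g i))"
  by (induction I rule: infinite_finite_induct) (simp_all add: unital_ring_hom_simps[OF assms])

lemma unital_ring_hom_power:
  assumes "unital_ring_hom f"
  shows "f (x ^ n) = f x ^ n"
  by (induction n) (simp_all add: unital_ring_hom_simps[OF assms])

context chart
begin

context
  fixes f :: "'a::{comm_ring,comm_monoid_mult} \<Rightarrow> 'b::{comm_ring,comm_monoid_mult}"
  assumes hom: "unital_ring_hom f"
begin

lemma lookup_map_hom: "Poly_Mapping.lookup (Poly_Mapping.map f p) k = f (Poly_Mapping.lookup p k)"
  by (simp add: map.rep_eq when_def unital_ring_hom_simps[OF hom])

lemma column_hom: "column (\<lambda>v. f (w v)) m j h = f (column w m j h)"
  by (simp add: column_def unital_ring_hom_simps[OF hom])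

lemma coord_hom: "coord (\<lambda>v. f (w v)) m j h = f (coord w m j h)"
proof (induction j arbitrary: h)
  case 0
  show ?case by (simp add: coord_def column_hom)
next
  case (Suc j)
  then show ?case
    by (simp add: coord_Suc mult_y_def column_hom unital_ring_hom_sum[OF hom] unital_ring_hom_simps[OF hom])
qed

lemma coords_hom: "coords (\<lambda>v. f (w v)) n (\<lambda>m. Poly_Mapping.map f (g m)) h = f (coords w n g h)"
  by (simp add: coords_def lookup_map_hom coord_hom unital_ring_hom_sum[OF hom] unital_ring_hom_simps[OF hom])

lemma map_hom_in_chart_module:
  assumes "g \<in> chart_module w"
  shows "(\<lambda>m. Poly_Mapping.map f (g m)) \<in> chart_module (\<lambda>v. f (w v))"
  using assms unfolding chart_module_def
  by (auto simp: coords_hom unital_ring_hom_simps[OF hom] free_module_def intro!: poly_mapping_eqI)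
     (simp add: lookup_map_hom unital_ring_hom_simps[OF hom])

lemma map_monomial_vec:
  "(\<lambda>m'. Poly_Mapping.map f (monomial_vec n m j m')) = monomial_vec n m j"
  by (intro ext poly_mapping_eqI)
    (simp add: lookup_map_hom monomial_vec_def lookup_single when_def unital_ring_hom_simps[OF hom])

lemma map_comb_chosen:
  "(\<lambda>m. Poly_Mapping.map f (comb c (chosen_monomials n il) m)) = comb (\<lambda>k. f (c k)) (chosen_monomials n il)"
proof (intro ext poly_mapping_eqI)
  fix m k
  have "f (Poly_Mapping.lookup ((chosen_monomials n il ! h) m) k) =
      Poly_Mapping.lookup ((chosen_monomials n il ! h) m) k" if "h < d" for h
  proof -
    obtain m' j where "positions ! h = (m', j)" by fastforce
    then show ?thesis
      using that fun_cong[OF map_monomial_vec, of n m' j m] lookup_map_hom[of "monomial_vec n m' j m" k]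
      by (simp add: chosen_monomials_nth)
  qed
  then show "Poly_Mapping.lookup (Poly_Mapping.map f (comb c (chosen_monomials n il) m)) k =
      Poly_Mapping.lookup (comb (\<lambda>k. f (c k)) (chosen_monomials n il) m) k"
    by (simp add: lookup_map_hom comb_def lookup_sum lookup_const_mult length_chosen_monomials
        unital_ring_hom_sum[OF hom] unital_ring_hom_simps[OF hom])
qed

text \<open>
  A submodule \<open>W\<close> that contains the image of \<open>chart_module w\<close> contains, for every monomial
  \<open>x\<^sup>n\<^sup>-\<^sup>jy\<^sup>je\<^sub>m\<close> with \<open>n \<ge> d\<close>, its difference from the combination of the chosen monomials with
  coordinates \<open>f (coord w m j)\<close>.  Hence \<open>W\<close> contains every homogeneous vector of degree \<open>\<ge> d\<close> whose
  image in \<open>B\<^sup>d\<close> is \<open>0\<close>.  The saturation takes care of the lower degrees.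
\<close>

lemma base_change_chart_module: "base_change r f (chart_module w) = chart_module (\<lambda>v. f (w v))"
proof
  let ?gens = "{W. is_submodule r W \<and> (\<forall>g\<in>chart_module w. (\<lambda>m. Poly_Mapping.map f (g m)) \<in> W)}"
  have "\<Inter>?gens \<subseteq> chart_module (\<lambda>v. f (w v))"
    using submodule_chart_module map_hom_in_chart_module by blast
  then have "saturation r (\<Inter>?gens) \<subseteq> saturation r (chart_module (\<lambda>v. f (w v)))"
    by (rule saturation_mono)
  also have "\<dots> \<subseteq> chart_module (\<lambda>v. f (w v))"
    using saturated_chart_module by (simp add: is_saturated_def)
  finally show "base_change r f (chart_module w) \<subseteq> chart_module (\<lambda>v. f (w v))"
    unfolding base_change_def .
  show "chart_module (\<lambda>v. f (w v)) \<subseteq> base_change r f (chart_module w)"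
  proof
    fix g assume g: "g \<in> chart_module (\<lambda>v. f (w v))"
    then have free: "g \<in> free_module r"
      by (simp add: chart_module_def)
    have "smult_vec (xy a b) g \<in> W" if "a + b = d" and "W \<in> ?gens" for a b W
    proof -
      interpret chart_submodule r d il W
        using that by unfold_locales auto
      have monomial: "congruent_mod W (monomial_vec n m j) (comb (coord (\<lambda>v. f (w v)) m j) (chosen_monomials n il))"
        if "m < r" "j \<le> n" "d \<le> n" for m j n
      proof -
        have "congruent_mod (chart_module w) (monomial_vec n m j) (comb (coord w m j) (chosen_monomials n il))"
        proof -
          have "coords w n (monomial_vec n m j) = coord w m j"
            using that by (intro ext coords_monomial)
          then show ?thesis
            using chart_module_congruence[OF that(3) monomial_vec_in_free_module_deg[OF that(1,2)], of w]
            by simp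
        qed
        then have "(\<lambda>m'. Poly_Mapping.map f (monomial_vec n m j m' - comb (coord w m j) (chosen_monomials n il) m')) \<in> W"
          using \<open>W \<in> ?gens\<close> by (simp add: congruent_mod_def)
        moreover have "Poly_Mapping.map f (p - q) = Poly_Mapping.map f p - Poly_Mapping.map f q" for p q :: "'a bipoly"
        proof (rule poly_mapping_eqI)
          fix k
          have "f (a - b) + f b = f a" for a b
            using unital_ring_hom_simps(2)[OF hom, of "a - b" b] by simp
          then show "Poly_Mapping.lookup (Poly_Mapping.map f (p - q)) k =
              Poly_Mapping.lookup (Poly_Mapping.map f p - Poly_Mapping.map f q) k"
            by (simp add: lookup_map_hom lookup_minus eq_diff_eq)
        qed
        moreover have "(\<lambda>k. f (coord w m j k)) = coord (\<lambda>v. f (w v)) m j"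
          by (simp add: fun_eq_iff coord_hom)
        ultimately show ?thesis
          using fun_cong[OF map_monomial_vec, of n m j] fun_cong[OF map_comb_chosen, of "coord w m j" n]
          by (simp add: congruent_mod_def)
      qed
      have "smult_vec (xy a b) (hom_component n g) \<in> W" for n
      proof -
        let ?g = "smult_vec (xy a b) (hom_component n g)"
        have "?g \<in> free_module_deg r (n + a + b)"
          by (intro smult_xy_in_free_module_deg hom_component_in_free_module_deg free)
        from homogeneous_congruence_coords[OF this monomial]
        have "congruent_mod W ?g (comb (coords (\<lambda>v. f (w v)) (n + a + b) ?g) (chosen_monomials (n + a + b) il))"
          using \<open>a + b = d\<close> by simp
        moreover have "?g \<in> chart_module (\<lambda>v. f (w v))"
          using graded_chart_module[of "\<lambda>v. f (w v)"] g
          by (intro chart_module_smult) (auto simp: is_graded_submodule_def)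
        then have "comb (coords (\<lambda>v. f (w v)) (n + a + b) ?g) (chosen_monomials (n + a + b) il) = (\<lambda>m. 0)"
          by (simp add: comb_def chart_module_def length_chosen_monomials)
        ultimately show ?thesis
          using cong_mem_iff zero_mem by metis
      qed
      moreover obtain D where "g = (\<lambda>m. \<Sum>n<D. hom_component n g m)"
        using hom_component_expansion[OF free] by blast
      then have "smult_vec (xy a b) g = (\<lambda>m. \<Sum>n<D. smult_vec (xy a b) (hom_component n g) m)"
        unfolding smult_vec_def sum_distrib_left[symmetric] by (simp add: fun_eq_iff)
      ultimately show ?thesis
        using sum_mem[of "{..<D}" "\<lambda>n. smult_vec (xy a b) (hom_component n g)"] by simp
    qed
    then show "g \<in> base_change r f (chart_module w)"
      unfolding base_change_def saturation_def using free by blast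
  qed
qed

end

end

section \<open>Points of affine space\<close>

definition monomial_value :: "('v \<Rightarrow> 'a::comm_monoid_mult) \<Rightarrow> ('v \<Rightarrow>\<^sub>0 nat) \<Rightarrow> 'a" where
  "monomial_value z t = (\<Prod>v\<in>Poly_Mapping.keys t. z v ^ Poly_Mapping.lookup t v)"

definition poly_value ::
  "('k::field \<Rightarrow> 'a::{comm_ring,comm_monoid_mult}) \<Rightarrow> ('v \<Rightarrow> 'a) \<Rightarrow> (('v \<Rightarrow>\<^sub>0 nat) \<Rightarrow>\<^sub>0 'k) \<Rightarrow> 'a" where
  "poly_value \<iota> z p = (\<Sum>t\<in>Poly_Mapping.keys p. \<iota> (Poly_Mapping.lookup p t) * monomial_value z t)"

lemma eval_hom_eq: "eval_hom \<iota> X z = restrict (poly_value \<iota> z) (poly_ring X)"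
  by (simp add: eval_hom_def poly_value_def[abs_def] monomial_value_def)

lemma monomial_value_superset:
  assumes "finite K" "Poly_Mapping.keys t \<subseteq> K"
  shows "monomial_value z t = (\<Prod>v\<in>K. z v ^ Poly_Mapping.lookup t v)"
  unfolding monomial_value_def
  by (rule prod.mono_neutral_left) (use assms in \<open>auto simp: in_keys_iff\<close>)

lemma monomial_value_add: "monomial_value z (s + t) = monomial_value z s * monomial_value z t"
proof -
  let ?K = "Poly_Mapping.keys s \<union> Poly_Mapping.keys t"
  have "monomial_value z u = (\<Prod>v\<in>?K. z v ^ Poly_Mapping.lookup u v)" if "u \<in> {s, t, s + t}" for u
    using that keys_add[of s t] by (intro monomial_value_superset) auto
  then show ?thesis
    by (simp add: lookup_add power_add prod.distrib)
qed

lemma poly_ring_add: "p \<in> poly_ring X \<Longrightarrow> q \<in> poly_ring X \<Longrightarrow> p + q \<in> poly_ring X"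
  using keys_add[of p q] by (auto simp: poly_ring_def)

lemma poly_ring_mult:
  assumes "p \<in> poly_ring X" "q \<in> poly_ring X"
  shows "p * q \<in> poly_ring X"
proof -
  have "Poly_Mapping.keys t \<subseteq> X" if "t \<in> Poly_Mapping.keys (p * q)" for t
  proof -
    obtain a b where t: "t = a + b" and "a \<in> Poly_Mapping.keys p" "b \<in> Poly_Mapping.keys q"
      using subsetD[OF keys_mult \<open>t \<in> Poly_Mapping.keys (p * q)\<close>] by auto
    then have "Poly_Mapping.keys a \<subseteq> X" "Poly_Mapping.keys b \<subseteq> X"
      using assms by (auto simp: poly_ring_def)
    then show ?thesis
      using keys_add[of a b] by (auto simp: t)
  qed
  then show ?thesis by (simp add: poly_ring_def)
qed

lemma poly_ring_single: "Poly_Mapping.keys t \<subseteq> X \<Longrightarrow> Poly_Mapping.single t c \<in> poly_ring X"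
  by (auto simp: poly_ring_def)

lemma poly_ring_poly_var: "v \<in> X \<Longrightarrow> poly_var v \<in> poly_ring X"
  by (simp add: poly_var_def poly_ring_single)

lemma poly_ring_zero: "0 \<in> poly_ring X"
  and poly_ring_one: "1 \<in> poly_ring X"
  by (simp_all add: poly_ring_def)

lemma poly_ring_sum: "(\<And>i. i \<in> I \<Longrightarrow> g i \<in> poly_ring X) \<Longrightarrow> (\<Sum>i\<in>I. g i) \<in> poly_ring X"
  by (induction I rule: infinite_finite_induct) (auto intro: poly_ring_add poly_ring_zero)

lemma poly_ring_prod: "(\<And>i. i \<in> I \<Longrightarrow> g i \<in> poly_ring X) \<Longrightarrow> (\<Prod>i\<in>I. g i) \<in> poly_ring X"
  by (induction I rule: infinite_finite_induct) (auto intro: poly_ring_mult poly_ring_one)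

lemma poly_ring_power: "p \<in> poly_ring X \<Longrightarrow> p ^ n \<in> poly_ring X"
  by (induction n) (auto intro: poly_ring_mult poly_ring_one)

lemma monomial_as_product_of_variables:
  "(Poly_Mapping.single t 1 :: ('v \<Rightarrow>\<^sub>0 nat) \<Rightarrow>\<^sub>0 'k::field) =
     (\<Prod>v\<in>Poly_Mapping.keys t. poly_var v ^ Poly_Mapping.lookup t v)"
proof -
  have power: "(poly_var v ^ n :: ('v \<Rightarrow>\<^sub>0 nat) \<Rightarrow>\<^sub>0 'k) = Poly_Mapping.single (Poly_Mapping.single v n) 1" for v n
  proof (induction n)
    case (Suc n)
    have "Poly_Mapping.single v 1 + Poly_Mapping.single v n = Poly_Mapping.single v (Suc n)"
      using single_add[of v 1 n] by simp
    then show ?case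
      using Suc by (simp add: poly_var_def mult_single)
  qed simp
  have "(\<Prod>v\<in>K. Poly_Mapping.single (Poly_Mapping.single v (Poly_Mapping.lookup t v)) 1) =
      (Poly_Mapping.single (\<Sum>v\<in>K. Poly_Mapping.single v (Poly_Mapping.lookup t v)) 1 :: ('v \<Rightarrow>\<^sub>0 nat) \<Rightarrow>\<^sub>0 'k)" for K
    by (induction K rule: infinite_finite_induct) (simp_all add: mult_single)
  then show ?thesis
    unfolding power using poly_mapping_as_sum_of_monomials[of t] by simp
qed

context
  fixes \<iota> :: "'k::field \<Rightarrow> 'a::{comm_ring,comm_monoid_mult}"
  assumes hom: "unital_ring_hom \<iota>"
begin

lemma poly_value_superset:
  assumes "finite K" "Poly_Mapping.keys p \<subseteq> K"
  shows "poly_value \<iota> z p = (\<Sum>t\<in>K. \<iota> (Poly_Mapping.lookup p t) * monomial_value z t)"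
  unfolding poly_value_def
  by (rule sum.mono_neutral_left)
    (use assms in \<open>auto simp: in_keys_iff unital_ring_hom_simps[OF hom]\<close>)

lemma poly_value_add: "poly_value \<iota> z (p + q) = poly_value \<iota> z p + poly_value \<iota> z q"
proof -
  let ?K = "Poly_Mapping.keys p \<union> Poly_Mapping.keys q"
  have "poly_value \<iota> z u = (\<Sum>t\<in>?K. \<iota> (Poly_Mapping.lookup u t) * monomial_value z t)"
    if "u \<in> {p, q, p + q}" for u
    using that keys_add[of p q] by (intro poly_value_superset) auto
  then show ?thesis
    by (simp add: lookup_add unital_ring_hom_simps[OF hom] distrib_right sum.distrib)
qed

lemma poly_value_sum: "poly_value \<iota> z (\<Sum>i\<in>I. g i) = (\<Sum>i\<in>I. poly_value \<iota> z (g i))"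
  by (induction I rule: infinite_finite_induct) (simp_all add: poly_value_add, simp_all add: poly_value_def)

lemma poly_value_single: "poly_value \<iota> z (Poly_Mapping.single t c) = \<iota> c * monomial_value z t"
  by (simp add: poly_value_superset[of "{t}"])

lemma poly_value_mult: "poly_value \<iota> z (p * q) = poly_value \<iota> z p * poly_value \<iota> z q"
proof -
  let ?p = "Poly_Mapping.lookup p" and ?q = "Poly_Mapping.lookup q"
  have "p * q = (\<Sum>s\<in>Poly_Mapping.keys p. Poly_Mapping.single s (?p s)) *
      (\<Sum>t\<in>Poly_Mapping.keys q. Poly_Mapping.single t (?q t))"
    by (rule arg_cong2[OF poly_mapping_as_sum_of_monomials poly_mapping_as_sum_of_monomials])
  also have "\<dots> = (\<Sum>s\<in>Poly_Mapping.keys p. \<Sum>t\<in>Poly_Mapping.keys q.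
      Poly_Mapping.single (s + t) (?p s * ?q t))"
    by (simp only: sum_product mult_single)
  finally have "poly_value \<iota> z (p * q) = (\<Sum>s\<in>Poly_Mapping.keys p. \<Sum>t\<in>Poly_Mapping.keys q.
      (\<iota> (?p s) * monomial_value z s) * (\<iota> (?q t) * monomial_value z t))"
    by (simp add: poly_value_sum poly_value_single monomial_value_add unital_ring_hom_simps[OF hom]
        mult.assoc mult.left_commute)
  then show ?thesis
    by (simp add: poly_value_def sum_product)
qed

lemma poly_value_poly_var: "poly_value \<iota> z (poly_var v) = z v"
  by (simp add: poly_var_def poly_value_single unital_ring_hom_simps[OF hom] monomial_value_def)

lemma eval_hom_poly_var: "v \<in> X \<Longrightarrow> eval_hom \<iota> X z (poly_var v) = z v"
  by (simp add: eval_hom_eq poly_ring_poly_var poly_value_poly_var)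

lemma eval_hom_in_Spec: "eval_hom \<iota> X z \<in> Spec_poly_ring_points \<iota> X"
proof -
  have "poly_value \<iota> z (Poly_Mapping.single 0 c) = \<iota> c" for c
    by (simp add: poly_value_single monomial_value_def)
  then show ?thesis
    by (simp add: eval_hom_eq Spec_poly_ring_points_def poly_value_add poly_value_mult
        poly_ring_add poly_ring_mult poly_ring_single)
qed

text \<open>
  The universal property of the polynomial ring: a homomorphism over \<open>k\<close> is determined by its values at
  the variables, because every polynomial is a sum of constants times products of variables.
\<close>

lemma Spec_point_eq_eval_hom:
  fixes X :: "'v set"
  assumes "g \<in> Spec_poly_ring_points \<iota> X"
  shows "g = eval_hom \<iota> X (\<lambda>v. g (poly_var v))"
proof
  have g: "g \<in> extensional (poly_ring X)" "\<And>c. g (Poly_Mapping.single 0 c) = \<iota> c"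
    "\<And>p q. p \<in> poly_ring X \<Longrightarrow> q \<in> poly_ring X \<Longrightarrow> g (p + q) = g p + g q"
    "\<And>p q. p \<in> poly_ring X \<Longrightarrow> q \<in> poly_ring X \<Longrightarrow> g (p * q) = g p * g q"
    using assms by (auto simp: Spec_poly_ring_points_def)
  have g0: "g 0 = 0" and g1: "g 1 = 1"
    using g(2)[of 0] g(2)[of 1] by (simp_all add: unital_ring_hom_simps[OF hom])
  have g_sum: "(\<And>i. i \<in> I \<Longrightarrow> q i \<in> poly_ring X) \<Longrightarrow> g (\<Sum>i\<in>I. q i) = (\<Sum>i\<in>I. g (q i))"
    for I :: "('v \<Rightarrow>\<^sub>0 nat) set" and q
    by (induction I rule: infinite_finite_induct) (simp_all add: g0 g(3) poly_ring_sum)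
  have g_prod: "(\<And>i. i \<in> I \<Longrightarrow> q i \<in> poly_ring X) \<Longrightarrow> g (\<Prod>i\<in>I. q i) = (\<Prod>i\<in>I. g (q i))"
    for I :: "'v set" and q
    by (induction I rule: infinite_finite_induct) (simp_all add: g1 g(4) poly_ring_prod)
  have g_power: "q \<in> poly_ring X \<Longrightarrow> g (q ^ n) = g q ^ n" for q n
    by (induction n) (simp_all add: g1 g(4) poly_ring_power)
  have monomial: "g (Poly_Mapping.single t c) = \<iota> c * monomial_value (\<lambda>v. g (poly_var v)) t"
    if t: "Poly_Mapping.keys t \<subseteq> X" for t c
  proof -
    have var: "poly_var v \<in> poly_ring X" if "v \<in> Poly_Mapping.keys t" for v
      using t that by (intro poly_ring_poly_var) auto
    have "g (Poly_Mapping.single t 1) =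
        (\<Prod>v\<in>Poly_Mapping.keys t. g (poly_var v ^ Poly_Mapping.lookup t v))"
      unfolding monomial_as_product_of_variables by (intro g_prod poly_ring_power var)
    also have "\<dots> = monomial_value (\<lambda>v. g (poly_var v)) t"
      unfolding monomial_value_def by (intro prod.cong refl g_power var)
    finally have "g (Poly_Mapping.single t 1) = monomial_value (\<lambda>v. g (poly_var v)) t" .
    moreover have "Poly_Mapping.single t c = Poly_Mapping.single 0 c * Poly_Mapping.single t 1"
      by (simp add: mult_single)
    ultimately show ?thesis
      using g(4)[of "Poly_Mapping.single 0 c" "Poly_Mapping.single t 1"] t
      by (simp add: g(2) poly_ring_single)
  qed
  fix p
  show "g p = eval_hom \<iota> X (\<lambda>v. g (poly_var v)) p"
  proof (cases "p \<in> poly_ring X")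
    case True
    then have keys: "Poly_Mapping.keys t \<subseteq> X" if "t \<in> Poly_Mapping.keys p" for t
      using that by (auto simp: poly_ring_def)
    have "g p = g (\<Sum>t\<in>Poly_Mapping.keys p. Poly_Mapping.single t (Poly_Mapping.lookup p t))"
      by (rule arg_cong[OF poly_mapping_as_sum_of_monomials])
    also have "\<dots> = (\<Sum>t\<in>Poly_Mapping.keys p. g (Poly_Mapping.single t (Poly_Mapping.lookup p t)))"
      by (intro g_sum poly_ring_single keys)
    finally have "g p = (\<Sum>t\<in>Poly_Mapping.keys p. g (Poly_Mapping.single t (Poly_Mapping.lookup p t)))" .
    then show ?thesis
      using True by (simp add: eval_hom_eq poly_value_def monomial keys)
  next
    case False
    then show ?thesis
      using extensional_arb[OF g(1)] by (simp add: eval_hom_eq)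
  qed
qed

end

lemma eval_hom_cong:
  assumes "\<And>v. v \<in> X \<Longrightarrow> z v = z' v"
  shows "eval_hom \<iota> X z = eval_hom \<iota> X z'"
proof -
  have "poly_value \<iota> z p = poly_value \<iota> z' p" if "p \<in> poly_ring X" for p
    unfolding poly_value_def monomial_value_def
    using that assms by (intro sum.cong arg_cong2[of _ _ _ _ "(*)"] prod.cong refl) (auto simp: poly_ring_def subset_iff)
  then show ?thesis
    by (auto simp: eval_hom_eq)
qed

lemma eval_hom_compose:
  assumes "unital_ring_hom f" "\<And>c. \<kappa> c = f (\<iota> c)"
  shows "eval_hom \<kappa> X (\<lambda>v. f (z v)) = compose (poly_ring X) f (eval_hom \<iota> X z)"
proof
  fix p
  have "poly_value \<kappa> (\<lambda>v. f (z v)) p = f (poly_value \<iota> z p)"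
    by (simp add: poly_value_def monomial_value_def assms(2) unital_ring_hom_sum[OF assms(1)]
        unital_ring_hom_prod[OF assms(1)] unital_ring_hom_power[OF assms(1)] unital_ring_hom_simps[OF assms(1)])
  then show "eval_hom \<kappa> X (\<lambda>v. f (z v)) p = compose (poly_ring X) f (eval_hom \<iota> X z) p"
    by (simp add: eval_hom_eq compose_def)
qed

section \<open>The chart is an isomorphism\<close>

context chart
begin

lemma phi_eq: "phi \<iota> r d il V = eval_hom \<iota> (w_indices r d) (chart_coords V)"
  by (simp add: phi_def chart_coords_def)

lemma phi_chart_module: "phi \<iota> r d il (chart_module w) = eval_hom \<iota> (w_indices r d) w"
  unfolding phi_eq by (rule eval_hom_cong) (auto simp: chart_coords_chart_module)

lemma Q_point_eq_chart_module: "V \<in> Q_points r d il \<Longrightarrow> V = chart_module (chart_coords V)"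
  by (intro Q_point.V_eq_chart_module Q_point.intro chart_axioms Q_point_axioms.intro)

lemma phi_bij_betw:
  fixes \<iota> :: "'k::field \<Rightarrow> 'a::{comm_ring,comm_monoid_mult}"
  assumes "unital_ring_hom \<iota>"
  shows "bij_betw (phi \<iota> r d il) (Q_points r d il) (Spec_poly_ring_points \<iota> (w_indices r d))"
proof (rule bij_betw_imageI)
  show "inj_on (phi \<iota> r d il) (Q_points r d il)"
  proof (rule inj_onI)
    fix V V' :: "'a bivec set"
    assume V: "V \<in> Q_points r d il" "V' \<in> Q_points r d il" and "phi \<iota> r d il V = phi \<iota> r d il V'"
    then have "chart_coords V v = chart_coords V' v" if "v \<in> w_indices r d" for v
      using eval_hom_poly_var[OF assms that] by (metis phi_eq)
    then have "chart_module (chart_coords V) = chart_module (chart_coords V')"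
      by (intro chart_module_cong) auto
    then show "V = V'"
      using V[THEN Q_point_eq_chart_module] by simp
  qed
  show "phi \<iota> r d il ` Q_points r d il = Spec_poly_ring_points \<iota> (w_indices r d)"
  proof (intro subset_antisym subsetI)
    show "g \<in> Spec_poly_ring_points \<iota> (w_indices r d)" if "g \<in> phi \<iota> r d il ` Q_points r d il" for g
      using that by (auto simp: phi_eq eval_hom_in_Spec[OF assms])
    fix g
    assume "g \<in> Spec_poly_ring_points \<iota> (w_indices r d)"
    then have "g = phi \<iota> r d il (chart_module (\<lambda>v. g (poly_var v)))"
      unfolding phi_chart_module by (rule Spec_point_eq_eval_hom[OF assms])
    then show "g \<in> phi \<iota> r d il ` Q_points r d il"
      using chart_module_in_Q_points by (rule image_eqI)
  qed
qed

end

theorem corollary4p3: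
  fixes \<iota> :: "'k::alg_closed_field \<Rightarrow> 'a::{comm_ring,comm_monoid_mult}"
    and r d :: nat and il :: "nat list"
  assumes "r \<ge> 2" and "d \<ge> 1"
    and "sorted_wrt (\<ge>) il" and "\<forall>i\<in>set il. i > 0"
    and "length il \<le> r" and "sum_list il = d"
    and "unital_ring_hom \<iota>"
  shows "bij_betw (phi \<iota> r d il) (Q_points r d il)
           (Spec_poly_ring_points \<iota> (w_indices r d)) \<and>
         (\<forall>V\<in>Q_points r d il. \<forall>h<d. \<forall>m<r.
           phi \<iota> r d il V (poly_var (h, m)) = C_matrix r d il V $$ (h, first_free_column d il m)) \<and>
         (\<forall>(\<kappa> :: 'k \<Rightarrow> 'b::{comm_ring,comm_monoid_mult}) (f :: 'a \<Rightarrow> 'b).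
           unital_ring_hom \<kappa> \<and> unital_ring_hom f \<and> f \<circ> \<iota> = \<kappa> \<longrightarrow>
           (\<forall>V\<in>Q_points r d il.
              base_change r f V \<in> Q_points r d il \<and>
              phi \<kappa> r d il (base_change r f V) =
                compose (poly_ring (w_indices r d)) f (phi \<iota> r d il V)))"
proof -
  interpret chart r d il
    using assms by unfold_locales
  show ?thesis
  proof (intro conjI ballI allI impI)
    show "bij_betw (phi \<iota> r d il) (Q_points r d il) (Spec_poly_ring_points \<iota> (w_indices r d))"
      using assms(7) by (rule phi_bij_betw)
    show "phi \<iota> r d il V (poly_var (h, m)) = C_matrix r d il V $$ (h, first_free_column d il m)"
      if "h < d" "m < r" for V h m
      using that eval_hom_poly_var[OF assms(7), of "(h, m)"] by (simp add: phi_eq chart_coords_def)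
    fix \<kappa> :: "'k \<Rightarrow> 'b" and f :: "'a \<Rightarrow> 'b" and V :: "'a bivec set"
    assume f: "unital_ring_hom \<kappa> \<and> unital_ring_hom f \<and> f \<circ> \<iota> = \<kappa>" and "V \<in> Q_points r d il"
    then have V: "V = chart_module (chart_coords V)"
      by (intro Q_point_eq_chart_module)
    from f have "base_change r f (chart_module (chart_coords V)) = chart_module (\<lambda>v. f (chart_coords V v))"
      by (intro base_change_chart_module) simp
    with V have bc: "base_change r f V = chart_module (\<lambda>v. f (chart_coords V v))"
      by simp
    show "base_change r f V \<in> Q_points r d il"
      unfolding bc by (rule chart_module_in_Q_points)
    show "phi \<kappa> r d il (base_change r f V) =
        compose (poly_ring (w_indices r d)) f (phi \<iota> r d il V)"
      unfolding bc phi_chart_module unfolding phi_eq using f by (intro eval_hom_compose) auto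
  qed
qed

end
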